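(* Let $T\in\mathbb{C}\setminus\{0\}$, let $p\colon\mathbb{C}\to\mathbb{C}$ be an entire $T$-periodic function such that the function $z\mapsto z+p(z)$ has an attracting fixed point at $z_0\in\mathbb{C}$, let $g\colon\mathbb{C}\to\mathbb{C}$ be entire with an attracting fixed point at $0$, and let $h\colon\mathbb{C}^2\to\mathbb{C}$ be entire. Put $f(z)=z+T+p(z)$ and consider the skew-product $F\colon\mathbb{C}^2\to\mathbb{C}^2$, $$F(z,w)=(f(z)+w\,h(z,w),\,g(w)).$$ Then the wandering domain $U_0$ of $f$ at $z_0$ bulges to a Fatou component of $F$, i.e. $U_0\times\{0\}$ is contained in the Fatou set of $F$ (for each of the three notions of normality: $\widehat{\mathbb{C}^2}$, $\mathbf{P}_2\mathbb{C}$ and $\widehat{\mathbb{C}}\times\widehat{\mathbb{C}}$), if one of the following holds: 1. $0$ is a geometrically attracting fixed point of $g$ and $\rho_1(h)<1$; or 2. $0$ is a superattracting fixed point of $g$ and $\rho_1(h)<\infty$.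
   Context: $\mathbb{N}$ includes $0$. A fixed point $c$ of an entire function $u$ is attracting if $|u'(c)|<1$, geometrically attracting if $0<|u'(c)|<1$, and superattracting if $u'(c)=0$. The Fatou set of an entire function of one variable is the set of normality (with values in the Riemann sphere) of its iterates; its connected components are called Fatou components. The wandering domain $U_0$ of $f$ at $z_0$ is the Fatou component of $f$ containing $z_0$; it is the (immediate) basin of attraction of $z_0$ for $z\mapsto z+p(z)$, and it is known that the sets $U_0+nT$, $n\in\mathbb{Z}$, are pairwise disjoint Fatou components of $f$ with $f(U_0+nT)\subset U_0+(n+1)T$. Order in the $z$ variable: for $h\colon\mathbb{C}^2\to\mathbb{C}$ entire and $r_1,r_2>0$ put $M(r_1,r_2;h)=\max_{|z|\le r_1,\,|w|\le r_2}|h(z,w)|$. The order of $h$ in the $z$ variable is $$\rho_1(h)=\limsup_{r_1\to\infty}\frac{\log^{+}\log M(r_1,r_2;h)}{\log r_1}\in[0,\infty]$$ for some $r_2>0$; for nonconstant $h$ this is known to be independent of the choice of $r_2>0$. Here $\log^+x=\max\{\log x,0\}$ for $x>0$ and $\log^+x=0$ for $x\le0$ (also when $\log M=-\infty$); with this convention constant functions have order $0$. Let $X$ be a complex manifold and let $\mathcal{F}$ be a family of holomorphic maps $X\to\mathbb{C}^2$. - $\mathcal{F}$ is $\widehat{\mathbb{C}^2}$-normal if every sequence in $\mathcal{F}$ either diverges uniformly to infinity on compact subsets of $X$ or has a subsequence converging uniformly on compact subsets to a holomorphic map $X\to\mathbb{C}^2$. (Here $\widehat{\mathbb{C}^2}$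 is the one-point compactification.) - $\mathcal{F}$ is $\mathbf{P}_2\mathbb{C}$-normal if every sequence in $\mathcal{F}$ has a subsequence converging uniformly on compact subsets to a holomorphic map $X\to\mathbf{P}_2\mathbb{C}$ (with $\mathbb{C}^2\subset\mathbf{P}_2\mathbb{C}$ the complex projective plane). - $\mathcal{F}$ is $(\widehat{\mathbb{C}})^2$-normal if every sequence in $\mathcal{F}$ has a subsequence converging uniformly on compact subsets to a holomorphic map $X\to\widehat{\mathbb{C}}\times\widehat{\mathbb{C}}$. For a holomorphic map $F\colon\mathbb{C}^2\to\mathbb{C}^2$ and any of these notions, the Fatou set of $F$ is the set of points having an open neighborhood on which the family of iterates $(F^n)_{n\in\mathbb{N}}$ is normal. When no notion is specified, statements are meant for all three. *)

theory Defs
  imports "HOL-Analysis.Analysis"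
begin

section \<open>Holomorphic functions of two variables and the order in the first variable\<close>

text \<open>
  \<open>f\<close> is complex differentiable at every point of \<open>S\<close>: the real Frechet derivative exists and is
  complex linear.  This is only used for open \<open>S\<close>.
\<close>
definition holomorphic2_on :: "(complex \<times> complex \<Rightarrow> complex) \<Rightarrow> (complex \<times> complex) set \<Rightarrow> bool"
    (infixl "holomorphic2'_on" 50) where
  "f holomorphic2_on S \<longleftrightarrow>
     (\<forall>x\<in>S. \<exists>a b. (f has_derivative (\<lambda>(u, v). a * u + b * v)) (at x))"

text \<open>The supremum is a maximum whenever \<open>h\<close> is continuous and \<open>r1, r2 \<ge> 0\<close>.\<close>
definition max_modulus2 :: "real \<Rightarrow> real \<Rightarrow> (complex \<times> complex \<Rightarrow> complex) \<Rightarrow> real" where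
  "max_modulus2 r1 r2 h = (SUP x\<in>cball 0 r1 \<times> cball 0 r2. cmod (h x))"

definition log_plus :: "real \<Rightarrow> real" where
  "log_plus x = (if x > 0 then max (ln x) 0 else 0)"

text \<open>
  The order in the \<open>z\<close> variable, computed with the radius \<open>r2 > 0\<close> in the \<open>w\<close> variable.  It does not
  depend on \<open>r2\<close>, so it is finite (or less than 1) iff it is so for some \<open>r2 > 0\<close>.
  For \<open>h = 0\<close> the library value \<open>ln 0 = 0\<close> gives \<open>log_plus (ln 0) = 0\<close>, which agrees with the
  convention that \<open>log\<^sup>+ (-\<infinity>) = 0\<close>.
\<close>
definition order_z :: "real \<Rightarrow> (complex \<times> complex \<Rightarrow> complex) \<Rightarrow> ereal" where
  "order_z r2 h = Limsup at_top (\<lambda>r1. ereal (log_plus (ln (max_modulus2 r1 r2 h)) / ln r1))"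


section \<open>Complex projective spaces\<close>

text \<open>
  \<open>'n cproj\<close> is the space of lines in \<open>complex ^ 'n\<close>, so its dimension is \<open>CARD('n) - 1\<close>: the
  projective plane is \<open>3 cproj\<close>, and the Riemann sphere is taken to be the projective line \<open>2 cproj\<close>.
  The quotient is partial: \<open>abs_cproj x\<close> is meaningful only for \<open>x \<noteq> 0\<close>.
\<close>
definition cproj_rel :: "complex ^ 'n \<Rightarrow> complex ^ 'n \<Rightarrow> bool" where
  "cproj_rel x y \<longleftrightarrow> x \<noteq> 0 \<and> y \<noteq> 0 \<and> (\<exists>c. y = c *s x)"

lemma part_equivp_cproj_rel: "part_equivp (cproj_rel :: complex ^ 'n \<Rightarrow> _)"
proof (rule part_equivpI)
  have "cproj_rel (axis undefined 1 :: complex ^ 'n) (axis undefined 1)"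
    unfolding cproj_rel_def by (auto simp: axis_eq_0_iff intro!: exI[of _ 1])
  then show "\<exists>x :: complex ^ 'n. cproj_rel x x" by blast
  show "symp (cproj_rel :: complex ^ 'n \<Rightarrow> _)"
  proof (rule sympI)
    fix x y :: "complex ^ 'n"
    assume "cproj_rel x y"
    then obtain c where c: "x \<noteq> 0" "y \<noteq> 0" "y = c *s x" by (auto simp: cproj_rel_def)
    then have "c \<noteq> 0" by auto
    with c have "x = inverse c *s y" by (simp add: vec_eq_iff)
    with c show "cproj_rel y x" unfolding cproj_rel_def by blast
  qed
  show "transp (cproj_rel :: complex ^ 'n \<Rightarrow> _)"
    by (rule transpI) (auto simp: cproj_rel_def vector_smult_assoc)
qed

quotient_type 'n cproj = "complex ^ ('n::finite)" / partial: cproj_rel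
  by (rule part_equivp_cproj_rel)

lemma norm_vector_scalar_mult: "norm (c *s x) = cmod c * norm x" for x :: "complex ^ 'n"
  by (simp add: norm_vec_def L2_set_def norm_mult power_mult_distrib real_sqrt_mult
      flip: sum_distrib_left)

text \<open>The matrix of the orthogonal projection onto the line spanned by \<open>x\<close>.\<close>
lift_definition proj_matrix :: "('n::finite) cproj \<Rightarrow> complex ^ 'n ^ 'n" is
  "\<lambda>x. \<chi> i j. x $ i * cnj (x $ j) / (norm x)\<^sup>2"
proof -
  fix x y :: "complex ^ 'n"
  assume "cproj_rel x y"
  then obtain c where c: "x \<noteq> 0" "y \<noteq> 0" "y = c *s x" by (auto simp: cproj_rel_def)
  then have "c \<noteq> 0" by auto
  have "(c * a) * cnj (c * b) / of_real ((cmod c * r)\<^sup>2) = a * cnj b / of_real (r\<^sup>2)" for a b r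
  proof -
    have "of_real ((cmod c * r)\<^sup>2) = (c * cnj c) * of_real (r\<^sup>2)"
      by (simp only: of_real_mult power_mult_distrib complex_norm_square)
    then have "(c * a) * cnj (c * b) / of_real ((cmod c * r)\<^sup>2) =
        ((c * cnj c) * (a * cnj b)) / ((c * cnj c) * of_real (r\<^sup>2))"
      by (simp only: complex_cnj_mult mult_ac)
    also have "\<dots> = a * cnj b / of_real (r\<^sup>2)"
      using \<open>c \<noteq> 0\<close> by (intro mult_divide_mult_cancel_left) simp
    finally show ?thesis .
  qed
  then show "(\<chi> i j. x $ i * cnj (x $ j) / (norm x)\<^sup>2) = (\<chi> i j. y $ i * cnj (y $ j) / (norm y)\<^sup>2)"
    unfolding c(3) norm_vector_scalar_mult by (simp only: vector_smult_component)
qed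

lemma inj_proj_matrix: "inj proj_matrix"
proof (rule injI)
  fix P Q :: "('n::finite) cproj"
  assume "proj_matrix P = proj_matrix Q"
  then show "P = Q"
  proof transfer
    fix x y :: "complex ^ 'n"
    assume "cproj_rel x x" "cproj_rel y y"
    then have nz: "x \<noteq> 0" "y \<noteq> 0" by (auto simp: cproj_rel_def)
    assume "(\<chi> i j. x $ i * cnj (x $ j) / (norm x)\<^sup>2) = (\<chi> i j. y $ i * cnj (y $ j) / (norm y)\<^sup>2)"
    then have eq: "x $ i * cnj (x $ j) / (norm x)\<^sup>2 = y $ i * cnj (y $ j) / (norm y)\<^sup>2" for i j
      by (simp add: vec_eq_iff)
    obtain j where j: "y $ j \<noteq> 0" using nz by (auto simp: vec_eq_iff)
    have "y $ i = (cnj (x $ j) / (norm x)\<^sup>2 * (norm y)\<^sup>2 / cnj (y $ j)) * x $ i" for i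
    proof -
      have "y $ i = (y $ i * cnj (y $ j) / (norm y)\<^sup>2) * ((norm y)\<^sup>2 / cnj (y $ j))"
        using nz j by simp
      also have "\<dots> = (x $ i * cnj (x $ j) / (norm x)\<^sup>2) * ((norm y)\<^sup>2 / cnj (y $ j))"
        by (simp only: eq)
      finally show ?thesis by (simp only: divide_inverse mult_ac)
    qed
    then have "y = (cnj (x $ j) / (norm x)\<^sup>2 * (norm y)\<^sup>2 / cnj (y $ j)) *s x"
      unfolding vec_eq_iff vector_smult_component by blast
    with nz show "cproj_rel x y" unfolding cproj_rel_def by blast
  qed
qed

text \<open>
  The distance of two lines is the Frobenius distance of the orthogonal projections onto them, i.e.
  \<open>sqrt 2\<close> times the sine of the angle between the lines.  It induces the usual (compact)
  topology, and therefore the usual notion of uniform convergence.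
\<close>
instantiation cproj :: (finite) metric_space
begin

definition dist_cproj :: "'a cproj \<Rightarrow> 'a cproj \<Rightarrow> real" where
  "dist_cproj P Q = dist (proj_matrix P) (proj_matrix Q)"

definition uniformity_cproj :: "('a cproj \<times> 'a cproj) filter" where
  "uniformity_cproj = (INF e\<in>{0<..}. principal {(P, Q). dist P Q < e})"

definition open_cproj :: "'a cproj set \<Rightarrow> bool" where
  "open_cproj U \<longleftrightarrow> (\<forall>P\<in>U. eventually (\<lambda>(P', Q). P' = P \<longrightarrow> Q \<in> U) uniformity)"

instance
proof
  fix P Q R :: "'a cproj"
  show "dist P Q = 0 \<longleftrightarrow> P = Q"
    using inj_proj_matrix by (auto simp: dist_cproj_def inj_def)
  show "dist P Q \<le> dist P R + dist Q R"
    unfolding dist_cproj_def by (rule dist_triangle2)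
qed (fact uniformity_cproj_def open_cproj_def)+

end

text \<open>
  The standard charts: chart \<open>i\<close> is defined where the \<open>i\<close>-th homogeneous coordinate does not vanish,
  and its \<open>j\<close>-th coordinate is the quotient of the \<open>j\<close>-th and the \<open>i\<close>-th homogeneous coordinate.
\<close>
lift_definition chart_dom :: "'n \<Rightarrow> ('n::finite) cproj \<Rightarrow> bool" is "\<lambda>i x. x $ i \<noteq> 0"
  by (auto simp: cproj_rel_def)

lift_definition chart_coord :: "'n \<Rightarrow> 'n \<Rightarrow> ('n::finite) cproj \<Rightarrow> complex" is
  "\<lambda>i j x. x $ j / x $ i"
  by (auto simp: cproj_rel_def)

definition holomorphic_cproj_on ::
    "(complex \<times> complex \<Rightarrow> ('n::finite) cproj) \<Rightarrow> (complex \<times> complex) set \<Rightarrow> bool"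
    (infixl "holomorphic'_cproj'_on" 50) where
  "f holomorphic_cproj_on S \<longleftrightarrow> continuous_on S f \<and>
     (\<forall>i j. (\<lambda>x. chart_coord i j (f x)) holomorphic2_on {x\<in>S. chart_dom i (f x)})"

definition to_sphere :: "complex \<Rightarrow> 2 cproj" where
  "to_sphere z = abs_cproj (vector [z, 1])"

definition to_P2 :: "complex \<times> complex \<Rightarrow> 3 cproj" where
  "to_P2 = (\<lambda>(z, w). abs_cproj (vector [z, w, 1]))"

definition to_sphere2 :: "complex \<times> complex \<Rightarrow> 2 cproj \<times> 2 cproj" where
  "to_sphere2 = (\<lambda>(z, w). (to_sphere z, to_sphere w))"


section \<open>Normal families and Fatou sets\<close>

definition converges_on_compacts ::
    "'a::topological_space set \<Rightarrow> (nat \<Rightarrow> 'a \<Rightarrow> 'b::metric_space) \<Rightarrow> ('a \<Rightarrow> 'b) \<Rightarrow> bool" where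
  "converges_on_compacts X \<phi> f \<longleftrightarrow>
     (\<forall>K. compact K \<and> K \<subseteq> X \<longrightarrow> uniform_limit K \<phi> f sequentially)"

definition diverges_on_compacts ::
    "'a::topological_space set \<Rightarrow> (nat \<Rightarrow> 'a \<Rightarrow> 'b::real_normed_vector) \<Rightarrow> bool" where
  "diverges_on_compacts X \<phi> \<longleftrightarrow>
     (\<forall>K. compact K \<and> K \<subseteq> X \<longrightarrow> (\<forall>R. \<forall>\<^sub>F n in sequentially. \<forall>x\<in>K. norm (\<phi> n x) > R))"

text \<open>
  Normality of families of entire functions of one variable with values in the Riemann sphere.
  The limits are not required to be holomorphic into the sphere, as this is automatic.
\<close>
definition sphere_normal :: "complex set \<Rightarrow> (complex \<Rightarrow> complex) set \<Rightarrow> bool" where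
  "sphere_normal X \<F> \<longleftrightarrow>
     (\<forall>\<phi>. range \<phi> \<subseteq> \<F> \<longrightarrow>
        (\<exists>r f. strict_mono (r :: nat \<Rightarrow> nat) \<and>
               converges_on_compacts X (\<lambda>n. to_sphere \<circ> \<phi> (r n)) f))"

definition hatC2_normal ::
    "(complex \<times> complex) set \<Rightarrow> (complex \<times> complex \<Rightarrow> complex \<times> complex) set \<Rightarrow> bool" where
  "hatC2_normal X \<F> \<longleftrightarrow>
     (\<forall>\<phi>. range \<phi> \<subseteq> \<F> \<longrightarrow>
        diverges_on_compacts X \<phi> \<or>
        (\<exists>r f. strict_mono (r :: nat \<Rightarrow> nat) \<and>
               (fst \<circ> f) holomorphic2_on X \<and> (snd \<circ> f) holomorphic2_on X \<and>
               converges_on_compacts X (\<lambda>n. \<phi> (r n)) f))"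

definition P2_normal ::
    "(complex \<times> complex) set \<Rightarrow> (complex \<times> complex \<Rightarrow> complex \<times> complex) set \<Rightarrow> bool" where
  "P2_normal X \<F> \<longleftrightarrow>
     (\<forall>\<phi>. range \<phi> \<subseteq> \<F> \<longrightarrow>
        (\<exists>r f. strict_mono (r :: nat \<Rightarrow> nat) \<and> f holomorphic_cproj_on X \<and>
               converges_on_compacts X (\<lambda>n. to_P2 \<circ> \<phi> (r n)) f))"

definition sphere2_normal ::
    "(complex \<times> complex) set \<Rightarrow> (complex \<times> complex \<Rightarrow> complex \<times> complex) set \<Rightarrow> bool" where
  "sphere2_normal X \<F> \<longleftrightarrow>
     (\<forall>\<phi>. range \<phi> \<subseteq> \<F> \<longrightarrow>
        (\<exists>r f. strict_mono (r :: nat \<Rightarrow> nat) \<and>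
               (fst \<circ> f) holomorphic_cproj_on X \<and> (snd \<circ> f) holomorphic_cproj_on X \<and>
               converges_on_compacts X (\<lambda>n. to_sphere2 \<circ> \<phi> (r n)) f))"

definition fatou_set ::
    "('a::topological_space set \<Rightarrow> ('a \<Rightarrow> 'a) set \<Rightarrow> bool) \<Rightarrow> ('a \<Rightarrow> 'a) \<Rightarrow> 'a set" where
  "fatou_set normal F =
     {x. \<exists>X. open X \<and> x \<in> X \<and> normal X (range (\<lambda>n. F ^^ n))}"

definition fatou_component :: "(complex \<Rightarrow> complex) \<Rightarrow> complex \<Rightarrow> complex set" where
  "fatou_component f z = connected_component_set (fatou_set sphere_normal f) z"


section \<open>Fixed points\<close>

definition attracting_fixed_point :: "(complex \<Rightarrow> complex) \<Rightarrow> complex \<Rightarrow> bool" where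
  "attracting_fixed_point u c \<longleftrightarrow> u c = c \<and> cmod (deriv u c) < 1"

definition geom_attracting_fixed_point :: "(complex \<Rightarrow> complex) \<Rightarrow> complex \<Rightarrow> bool" where
  "geom_attracting_fixed_point u c \<longleftrightarrow> u c = c \<and> 0 < cmod (deriv u c) \<and> cmod (deriv u c) < 1"

definition superattracting_fixed_point :: "(complex \<Rightarrow> complex) \<Rightarrow> complex \<Rightarrow> bool" where
  "superattracting_fixed_point u c \<longleftrightarrow> u c = c \<and> deriv u c = 0"

end

theory Submission
  imports Defs "HOL-Complex_Analysis.Great_Picard" "HOL-Real_Asymp.Real_Asymp"
begin

text \<open>
  Write \<open>u z = z + p z\<close>, so that \<open>f\<^sup>n z = u\<^sup>n z + n T\<close>.  The Fatou component of \<open>f\<close> at \<open>z0\<close> lies in the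
  basin of \<open>z0\<close> under \<open>u\<close>: near a boundary point of the basin where the iterates of \<open>f\<close> are normal they
  tend to infinity uniformly, since they do so on the basin.  By Picard's theorem \<open>p\<close> takes the value
  \<open>- T\<close> or \<open>- 2 T\<close> at some \<open>c\<close>, and the orbits of \<open>c + j T\<close> are then fixed or return to \<open>c\<close>; hence late
  iterates \<open>u\<^sup>n\<close> omit all of \<open>c + j T\<close> with \<open>j \<ge> 0\<close>, are normal by Montel's theorem, and converge to \<open>z0\<close>.

  In the coordinate \<open>z - n T\<close> the skew product perturbs \<open>u\<close> by \<open>w\<^sub>n h (z\<^sub>n, w\<^sub>n)\<close>, where \<open>z\<^sub>n\<close> grows
  linearly.  The decay of \<open>w\<^sub>n\<close> (geometric, or doubly exponential in the superattracting case) beats the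
  growth of \<open>h\<close> (order less than 1, or finite), so orbits that have entered the attracting disc of \<open>u\<close>
  stay there.  Consequently \<open>z\<^sub>n\<close> tends to infinity and \<open>w\<^sub>n\<close> to 0, uniformly near each point of
  \<open>U\<^sub>0 \<times> {0}\<close>.
\<close>

section \<open>Holomorphic functions of two variables\<close>

lemma holomorphic2_on_imp_continuous_on: "u holomorphic2_on S \<Longrightarrow> continuous_on S u"
  unfolding holomorphic2_on_def
  by (metis continuous_at_imp_continuous_on has_derivative_continuous)

lemma holomorphic2_on_const: "(\<lambda>x. c) holomorphic2_on S"
proof -
  have "((\<lambda>_. c) has_derivative (\<lambda>(u, v). 0 * u + 0 * v)) (at x)" for x :: "complex \<times> complex"
    by (rule has_derivative_eq_rhs[OF has_derivative_const]) auto
  then show ?thesis unfolding holomorphic2_on_def by blast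
qed

lemma holomorphic2_on_fst: "fst holomorphic2_on S"
proof -
  have "(fst has_derivative (\<lambda>(u, v). 1 * u + 0 * v)) (at x)" for x :: "complex \<times> complex"
    by (rule has_derivative_eq_rhs[OF has_derivative_fst[OF has_derivative_ident]]) auto
  then show ?thesis unfolding holomorphic2_on_def by blast
qed

lemma holomorphic2_on_snd: "snd holomorphic2_on S"
proof -
  have "(snd has_derivative (\<lambda>(u, v). 0 * u + 1 * v)) (at x)" for x :: "complex \<times> complex"
    by (rule has_derivative_eq_rhs[OF has_derivative_snd[OF has_derivative_ident]]) auto
  then show ?thesis unfolding holomorphic2_on_def by blast
qed

lemma holomorphic2_on_compose:
  assumes "h holomorphic2_on UNIV" "u holomorphic2_on S" "v holomorphic2_on S"
  shows "(\<lambda>x. h (u x, v x)) holomorphic2_on S"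
  unfolding holomorphic2_on_def
proof
  fix x assume "x \<in> S"
  obtain a b where h: "(h has_derivative (\<lambda>(s, t). a * s + b * t)) (at (u x, v x))"
    using assms(1) unfolding holomorphic2_on_def by blast
  obtain c d where u: "(u has_derivative (\<lambda>(s, t). c * s + d * t)) (at x)"
    using assms(2) \<open>x \<in> S\<close> unfolding holomorphic2_on_def by blast
  obtain c' d' where v: "(v has_derivative (\<lambda>(s, t). c' * s + d' * t)) (at x)"
    using assms(3) \<open>x \<in> S\<close> unfolding holomorphic2_on_def by blast
  have "((\<lambda>x. h (u x, v x)) has_derivative
      (\<lambda>(s, t). (a * c + b * c') * s + (a * d + b * d') * t)) (at x)"
    by (rule has_derivative_eq_rhs[OF has_derivative_compose[OF has_derivative_Pair[OF u v] h]])
      (auto simp: fun_eq_iff algebra_simps)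
  then show "\<exists>a b. ((\<lambda>x. h (u x, v x)) has_derivative (\<lambda>(s, t). a * s + b * t)) (at x)" by blast
qed

lemma holomorphic2_on_compose1:
  assumes "g holomorphic_on UNIV" "u holomorphic2_on S"
  shows "(\<lambda>x. g (u x)) holomorphic2_on S"
  unfolding holomorphic2_on_def
proof
  fix x assume "x \<in> S"
  obtain a where "(g has_field_derivative a) (at (u x))"
    using assms(1) by (auto simp: holomorphic_on_def field_differentiable_def)
  then have g: "(g has_derivative (\<lambda>s. a * s)) (at (u x))" by (simp add: has_field_derivative_def)
  obtain c d where u: "(u has_derivative (\<lambda>(s, t). c * s + d * t)) (at x)"
    using assms(2) \<open>x \<in> S\<close> unfolding holomorphic2_on_def by blast
  have "((\<lambda>x. g (u x)) has_derivative (\<lambda>(s, t). (a * c) * s + (a * d) * t)) (at x)"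
    by (rule has_derivative_eq_rhs[OF has_derivative_compose[OF u g]])
      (auto simp: fun_eq_iff algebra_simps)
  then show "\<exists>a b. ((\<lambda>x. g (u x)) has_derivative (\<lambda>(s, t). a * s + b * t)) (at x)" by blast
qed

lemma holomorphic2_on_add:
  assumes "u holomorphic2_on S" "v holomorphic2_on S"
  shows "(\<lambda>x. u x + v x) holomorphic2_on S"
  unfolding holomorphic2_on_def
proof
  fix x assume "x \<in> S"
  obtain c d where u: "(u has_derivative (\<lambda>(s, t). c * s + d * t)) (at x)"
    using assms(1) \<open>x \<in> S\<close> unfolding holomorphic2_on_def by blast
  obtain c' d' where v: "(v has_derivative (\<lambda>(s, t). c' * s + d' * t)) (at x)"
    using assms(2) \<open>x \<in> S\<close> unfolding holomorphic2_on_def by blast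
  have "((\<lambda>x. u x + v x) has_derivative (\<lambda>(s, t). (c + c') * s + (d + d') * t)) (at x)"
    by (rule has_derivative_eq_rhs[OF has_derivative_add[OF u v]])
      (auto simp: fun_eq_iff algebra_simps)
  then show "\<exists>a b. ((\<lambda>x. u x + v x) has_derivative (\<lambda>(s, t). a * s + b * t)) (at x)" by blast
qed

lemma holomorphic2_on_mult:
  assumes "u holomorphic2_on S" "v holomorphic2_on S"
  shows "(\<lambda>x. u x * v x) holomorphic2_on S"
  unfolding holomorphic2_on_def
proof
  fix x assume "x \<in> S"
  obtain c d where u: "(u has_derivative (\<lambda>(s, t). c * s + d * t)) (at x)"
    using assms(1) \<open>x \<in> S\<close> unfolding holomorphic2_on_def by blast
  obtain c' d' where v: "(v has_derivative (\<lambda>(s, t). c' * s + d' * t)) (at x)"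
    using assms(2) \<open>x \<in> S\<close> unfolding holomorphic2_on_def by blast
  have "((\<lambda>x. u x * v x) has_derivative
      (\<lambda>(s, t). (u x * c' + c * v x) * s + (u x * d' + d * v x) * t)) (at x)"
    by (rule has_derivative_eq_rhs[OF has_derivative_mult[OF u v]])
      (auto simp: fun_eq_iff algebra_simps)
  then show "\<exists>a b. ((\<lambda>x. u x * v x) has_derivative (\<lambda>(s, t). a * s + b * t)) (at x)" by blast
qed

lemma holomorphic2_on_divide:
  assumes "u holomorphic2_on S" "v holomorphic2_on S" "\<And>x. x \<in> S \<Longrightarrow> v x \<noteq> 0"
  shows "(\<lambda>x. u x / v x) holomorphic2_on S"
  unfolding holomorphic2_on_def
proof
  fix x assume "x \<in> S"
  obtain c d where u: "(u has_derivative (\<lambda>(s, t). c * s + d * t)) (at x)"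
    using assms(1) \<open>x \<in> S\<close> unfolding holomorphic2_on_def by blast
  obtain c' d' where v: "(v has_derivative (\<lambda>(s, t). c' * s + d' * t)) (at x)"
    using assms(2) \<open>x \<in> S\<close> unfolding holomorphic2_on_def by blast
  have "((\<lambda>x. u x / v x) has_derivative
      (\<lambda>(s, t). ((c * v x - u x * c') / (v x * v x)) * s
              + ((d * v x - u x * d') / (v x * v x)) * t)) (at x)"
    by (rule has_derivative_eq_rhs[OF has_derivative_divide'[OF u v assms(3)[OF \<open>x \<in> S\<close>]]])
      (use assms(3)[OF \<open>x \<in> S\<close>] in \<open>auto simp: fun_eq_iff field_simps\<close>)
  then show "\<exists>a b. ((\<lambda>x. u x / v x) has_derivative (\<lambda>(s, t). a * s + b * t)) (at x)" by blast
qed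

lemma holomorphic2_on_funpow:
  assumes "(fst \<circ> F) holomorphic2_on UNIV" "(snd \<circ> F) holomorphic2_on UNIV"
  shows "(fst \<circ> F ^^ n) holomorphic2_on UNIV \<and> (snd \<circ> F ^^ n) holomorphic2_on UNIV"
proof (induction n)
  case 0
  then show ?case using holomorphic2_on_fst holomorphic2_on_snd by (simp add: o_def)
next
  case (Suc n)
  from holomorphic2_on_compose[OF assms(1) conjunct1[OF Suc] conjunct2[OF Suc]]
    holomorphic2_on_compose[OF assms(2) conjunct1[OF Suc] conjunct2[OF Suc]]
  show ?case by (simp add: o_def)
qed

section \<open>Holomorphic maps into projective spaces\<close>

lemma cproj_rel_refl_iff: "cproj_rel x x \<longleftrightarrow> x \<noteq> 0"
  unfolding cproj_rel_def by (auto intro: exI[of _ 1])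

lemma chart_dom_abs: "x \<noteq> 0 \<Longrightarrow> chart_dom i (abs_cproj x) \<longleftrightarrow> x $ i \<noteq> 0"
  by (simp add: chart_dom.abs_eq cproj_rel_refl_iff)

lemma chart_coord_abs: "x \<noteq> 0 \<Longrightarrow> chart_coord i j (abs_cproj x) = x $ j / x $ i"
  by (simp add: chart_coord.abs_eq cproj_rel_refl_iff)

lemma proj_matrix_abs:
  "x \<noteq> 0 \<Longrightarrow> proj_matrix (abs_cproj x) = (\<chi> i j. x $ i * cnj (x $ j) / (norm x)\<^sup>2)"
  by (simp add: proj_matrix.abs_eq cproj_rel_refl_iff)

lemma abs_cproj_eqI: "x \<noteq> 0 \<Longrightarrow> c \<noteq> 0 \<Longrightarrow> y = c *s x \<Longrightarrow> abs_cproj x = abs_cproj y"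
  by (rule Quotient_rel_abs[OF Quotient_cproj]) (auto simp: cproj_rel_def)

text \<open>The metric on lines is pulled back from projection matrices, and their entries are
  continuous in a nonzero spanning vector.\<close>

lemma tendsto_abs_cproj:
  assumes "(v \<longlongrightarrow> l) F" "l \<noteq> 0" "\<And>x. v x \<noteq> 0"
  shows "((\<lambda>x. abs_cproj (v x)) \<longlongrightarrow> abs_cproj l) F"
proof -
  have "((\<lambda>x. \<chi> i j. v x $ i * cnj (v x $ j) / (norm (v x))\<^sup>2) \<longlongrightarrow>
      (\<chi> i j. l $ i * cnj (l $ j) / (norm l)\<^sup>2)) F"
    using assms by (intro tendsto_intros) auto
  then show ?thesis
    using assms by (subst tendsto_dist_iff) (simp add: dist_cproj_def proj_matrix_abs flip: tendsto_dist_iff)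
qed

lemma continuous_on_abs_cproj:
  assumes "continuous_on S v" "\<And>x. v x \<noteq> 0"
  shows "continuous_on S (\<lambda>x. abs_cproj (v x))"
  using assms unfolding continuous_on_def by (blast intro: tendsto_abs_cproj)

text \<open>In chart \<open>i\<close> the map has coordinates \<open>v x $ j / v x $ i\<close>,
  quotients of holomorphic functions with nonvanishing denominator.\<close>

lemma holomorphic_cproj_on_abs:
  assumes hol: "\<And>i. (\<lambda>x. v x $ i) holomorphic2_on S" and nz: "\<And>x. v x \<noteq> 0"
  shows "(\<lambda>x. abs_cproj (v x)) holomorphic_cproj_on S"
  unfolding holomorphic_cproj_on_def
proof (intro conjI allI)
  have "continuous_on S (\<lambda>x. \<chi> i. v x $ i)"
    by (intro continuous_on_vec_lambda holomorphic2_on_imp_continuous_on hol)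
  then show "continuous_on S (\<lambda>x. abs_cproj (v x))"
    using nz by (intro continuous_on_abs_cproj) auto
  fix i j
  have "(\<lambda>x. v x $ k) holomorphic2_on {x \<in> S. v x $ i \<noteq> 0}" for k
    using hol[of k] by (auto simp: holomorphic2_on_def)
  then have "(\<lambda>x. v x $ j / v x $ i) holomorphic2_on {x \<in> S. v x $ i \<noteq> 0}"
    by (intro holomorphic2_on_divide) auto
  then show "(\<lambda>x. chart_coord i j (abs_cproj (v x))) holomorphic2_on
      {x \<in> S. chart_dom i (abs_cproj (v x))}"
    by (simp add: chart_dom_abs chart_coord_abs nz)
qed

lemma holomorphic_cproj_on_const: "x \<noteq> 0 \<Longrightarrow> (\<lambda>_. abs_cproj x) holomorphic_cproj_on S"
  by (rule holomorphic_cproj_on_abs) (auto intro: holomorphic2_on_const)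

section \<open>Points at infinity of the sphere and of the projective plane\<close>

lemma vector2_nonzero: "vector [z, 1] \<noteq> (0 :: complex ^ 2)" "vector [1, z] \<noteq> (0 :: complex ^ 2)"
  by (auto simp: vec_eq_iff forall_2)

lemma vector3_nonzero:
  "vector [z, w, 1] \<noteq> (0 :: complex ^ 3)" "vector [1, z, w] \<noteq> (0 :: complex ^ 3)"
  by (auto simp: vec_eq_iff forall_3)

definition sphere_infinity :: "2 cproj" where
  "sphere_infinity = abs_cproj (vector [1, 0])"

text \<open>The point where the closure of the z axis meets the line at infinity; all orbits
  considered below converge to it.\<close>

definition P2_horizontal_infinity :: "3 cproj" where
  "P2_horizontal_infinity = abs_cproj (vector [1, 0, 0])"

lemma to_sphere_inverse: "z \<noteq> 0 \<Longrightarrow> to_sphere z = abs_cproj (vector [1, inverse z])"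
  unfolding to_sphere_def
  by (rule abs_cproj_eqI[where c = "inverse z"]) (auto simp: vec_eq_iff forall_2 vector2_nonzero)

lemma to_P2_inverse: "z \<noteq> 0 \<Longrightarrow> to_P2 (z, w) = abs_cproj (vector [1, w / z, inverse z])"
  unfolding to_P2_def split
  by (rule abs_cproj_eqI[where c = "inverse z"])
    (auto simp: vec_eq_iff forall_3 vector3_nonzero field_simps)

text \<open>The bound is the difference of the (2,2) entries of the two projection matrices. It
  turns closeness to infinity on the sphere into a lower bound for \<open>cmod z\<close>.\<close>

lemma dist_to_sphere_infinity_ge: "1 / (1 + (cmod z)\<^sup>2) \<le> dist (to_sphere z) sphere_infinity"
proof -
  let ?A = "proj_matrix (to_sphere z)" and ?B = "proj_matrix sphere_infinity"
  have n: "(norm (vector [z, 1] :: complex ^ 2))\<^sup>2 = 1 + (cmod z)\<^sup>2"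
    by (simp add: norm_vec_def L2_set_def UNIV_2)
  have "dist (?A $ 2 $ 2) (?B $ 2 $ 2) \<le> dist (?A $ 2) (?B $ 2)" by (rule dist_vec_nth_le)
  also have "\<dots> \<le> dist ?A ?B" by (rule dist_vec_nth_le)
  finally have *: "dist (?A $ 2 $ 2) (?B $ 2 $ 2) \<le> dist (to_sphere z) sphere_infinity"
    by (simp add: dist_cproj_def)
  have "?A $ 2 $ 2 = of_real (1 / (1 + (cmod z)\<^sup>2))"
    using n by (simp add: to_sphere_def proj_matrix_abs vector2_nonzero flip: of_real_power)
  moreover have "?B $ 2 $ 2 = 0"
    by (simp add: sphere_infinity_def proj_matrix_abs vector2_nonzero)
  moreover have "0 \<le> 1 / (1 + (cmod z)\<^sup>2)" by simp
  ultimately have "dist (?A $ 2 $ 2) (?B $ 2 $ 2) = 1 / (1 + (cmod z)\<^sup>2)"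
    by (simp only: dist_norm diff_0_right norm_of_real abs_of_nonneg)
  then show ?thesis using * by simp
qed

lemma tendsto_vector2:
  fixes a b :: "'x \<Rightarrow> complex"
  assumes "(a \<longlongrightarrow> l) F" "(b \<longlongrightarrow> m) F"
  shows "((\<lambda>x. vector [a x, b x] :: complex ^ 2) \<longlongrightarrow> vector [l, m]) F"
proof (rule vec_tendstoI)
  fix i :: 2
  show "((\<lambda>x. (vector [a x, b x] :: complex ^ 2) $ i) \<longlongrightarrow> vector [l, m] $ i) F"
    using exhaust_2[of i] assms by auto
qed

lemma tendsto_vector3:
  fixes a b c :: "'x \<Rightarrow> complex"
  assumes "(a \<longlongrightarrow> l) F" "(b \<longlongrightarrow> m) F" "(c \<longlongrightarrow> n) F"
  shows "((\<lambda>x. vector [a x, b x, c x] :: complex ^ 3) \<longlongrightarrow> vector [l, m, n]) F"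
proof (rule vec_tendstoI)
  fix i :: 3
  show "((\<lambda>x. (vector [a x, b x, c x] :: complex ^ 3) $ i) \<longlongrightarrow> vector [l, m, n] $ i) F"
    using exhaust_3[of i] assms by auto
qed

lemma continuous_on_to_sphere: "continuous_on S to_sphere"
  unfolding to_sphere_def continuous_on_def
  by (intro ballI tendsto_abs_cproj tendsto_vector2 vector2_nonzero tendsto_ident_at tendsto_const)

lemma to_sphere_near_infinity:
  assumes "e > 0"
  obtains R where "\<And>z. cmod z > R \<Longrightarrow> dist (to_sphere z) sphere_infinity < e"
proof -
  have lim: "((\<lambda>u. abs_cproj (vector [1, u] :: complex ^ 2)) \<longlongrightarrow> sphere_infinity) (nhds 0)"
    unfolding sphere_infinity_def
    by (intro tendsto_abs_cproj tendsto_vector2 vector2_nonzero tendsto_const filterlim_ident)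
  obtain d where d: "d > 0"
      "\<And>u. dist u 0 < d \<Longrightarrow> dist (abs_cproj (vector [1, u] :: complex ^ 2)) sphere_infinity < e"
    using tendstoD[OF lim assms] unfolding eventually_nhds_metric by blast
  show thesis
  proof (rule that[of "1 / d"])
    fix z :: complex assume z: "cmod z > 1 / d"
    moreover have "1 / d > 0" using d by simp
    ultimately have "cmod z > 0" by linarith
    then have "z \<noteq> 0" by auto
    moreover have "dist (inverse z) 0 < d"
      using less_imp_inverse_less[OF z] d(1) by (simp add: norm_inverse)
    ultimately show "dist (to_sphere z) sphere_infinity < e"
      using d(2) by (simp add: to_sphere_inverse)
  qed
qed

lemma to_P2_near_infinity:
  assumes "e > 0"
  obtains R d where "d > 0"
    "\<And>z w. cmod z > R \<Longrightarrow> cmod w < d \<Longrightarrow> dist (to_P2 (z, w)) P2_horizontal_infinity < e"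
proof -
  let ?o = "(0, 0) :: complex \<times> complex"
  have "((\<lambda>x. abs_cproj (vector [1, fst x, snd x] :: complex ^ 3)) \<longlongrightarrow>
      abs_cproj (vector [1, fst ?o, snd ?o])) (nhds ?o)"
    by (intro tendsto_abs_cproj tendsto_vector3 vector3_nonzero tendsto_const
        tendsto_fst[OF filterlim_ident] tendsto_snd[OF filterlim_ident])
  then have lim: "((\<lambda>x. abs_cproj (vector [1, fst x, snd x] :: complex ^ 3)) \<longlongrightarrow>
      P2_horizontal_infinity) (nhds (0, 0))"
    by (simp add: P2_horizontal_infinity_def)
  obtain d where d: "d > 0" "\<And>x. dist x (0, 0) < d \<Longrightarrow>
      dist (abs_cproj (vector [1, fst x, snd x] :: complex ^ 3)) P2_horizontal_infinity < e"
    using tendstoD[OF lim assms] unfolding eventually_nhds_metric by blast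
  show thesis
  \<comment> \<open>The summand 1 gives \<open>cmod (w / z) \<le> cmod w < d / 2\<close>, and the
    summand \<open>2 / d\<close> gives \<open>cmod (inverse z) < d / 2\<close>.\<close>
  proof (rule that[of "d / 2" "1 + 2 / d"])
    fix z w :: complex assume z: "cmod z > 1 + 2 / d" and w: "cmod w < d / 2"
    have "2 / d > 0" using d by simp
    then have "cmod z > 1" using z by linarith
    then have "z \<noteq> 0" by auto
    have "cmod (w / z) \<le> cmod w" using \<open>cmod z > 1\<close>
      by (simp add: norm_divide divide_le_eq mult_left_le mult_le_cancel_left1)
    moreover have "cmod z > 2 / d" using z by linarith
    then have "cmod (inverse z) < d / 2"
      using less_imp_inverse_less[of "2 / d" "cmod z"] d(1) by (simp add: norm_inverse)
    moreover have "dist (w / z, inverse z) (0, 0) \<le> cmod (w / z) + cmod (inverse z)"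
      by (simp add: dist_Pair_Pair sqrt_sum_squares_le_sum)
    ultimately have "dist (w / z, inverse z) (0, 0) < d" using w by linarith
    from d(2)[OF this] show "dist (to_P2 (z, w)) P2_horizontal_infinity < e"
      using \<open>z \<noteq> 0\<close> by (simp add: to_P2_inverse)
  qed (use d in simp)
qed

section \<open>Escaping iterates are normal\<close>

text \<open>Either some value is taken infinitely often, or all fibres are finite. The first
  alternative concerns the whole sequence because divergence in \<open>hatC2_normal\<close> does not
  allow passing to a subsequence.\<close>

lemma nat_seq_at_top_or_constant_subseq:
  fixes k :: "nat \<Rightarrow> nat"
  obtains "filterlim k at_top sequentially"
  | m r where "strict_mono (r :: nat \<Rightarrow> nat)" "\<And>i. k (r i) = m"
proof (cases "\<exists>m. infinite {i. k i = m}")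
  case True
  then obtain m where m: "infinite {i. k i = m}" by blast
  from that(2)[OF strict_mono_enumerate[OF m]] enumerate_in_set[OF m] show thesis by blast
next
  case False
  have "finite {i. k i < M}" for M
  proof -
    have "{i. k i < M} = (\<Union>m<M. {i. k i = m})" by auto
    then show ?thesis using False by auto
  qed
  then have "\<forall>\<^sub>F i in cofinite. M \<le> k i" for M
    by (simp add: eventually_cofinite not_le)
  then have "filterlim k at_top sequentially"
    by (simp add: filterlim_at_top cofinite_eq_sequentially)
  then show thesis by (rule that(1))
qed

text \<open>
  A sequence of iterates has a constant subsequence, or its exponents tend to infinity and the
  iterates converge to the point at infinity in each of the three compactifications.
\<close>
lemma escaping_normal:
  assumes hol: "(fst \<circ> F) holomorphic2_on UNIV" "(snd \<circ> F) holomorphic2_on UNIV"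
    and esc: "\<And>R. \<forall>\<^sub>F n in sequentially. \<forall>x\<in>X. cmod (fst ((F ^^ n) x)) > R"
    and van: "\<And>e. e > 0 \<Longrightarrow> \<forall>\<^sub>F n in sequentially. \<forall>x\<in>X. cmod (snd ((F ^^ n) x)) < e"
  shows "hatC2_normal X (range (\<lambda>n. F ^^ n))" "P2_normal X (range (\<lambda>n. F ^^ n))"
    "sphere2_normal X (range (\<lambda>n. F ^^ n))"
proof -
  have holn: "(\<lambda>x. fst ((F ^^ n) x)) holomorphic2_on S" "(\<lambda>x. snd ((F ^^ n) x)) holomorphic2_on S"
    for n S
    using holomorphic2_on_funpow[OF hol, of n] by (auto simp: holomorphic2_on_def o_def)
  have iterates: "\<exists>k. \<forall>i. \<phi> i = F ^^ (k i)" if "range \<phi> \<subseteq> range (\<lambda>n. F ^^ n)" for \<phi> :: "nat \<Rightarrow> _"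
    using that by (intro choice) auto
  have const_conv: "converges_on_compacts X (\<lambda>i. G) G" for G :: "complex \<times> complex \<Rightarrow> 'a::metric_space"
    by (simp add: converges_on_compacts_def uniform_limit_const)
  have esc_seq: "\<forall>\<^sub>F i in sequentially. \<forall>x\<in>X. cmod (fst ((F ^^ k i) x)) > R"
    and van_seq: "e > 0 \<Longrightarrow> \<forall>\<^sub>F i in sequentially. \<forall>x\<in>X. cmod (snd ((F ^^ k i) x)) < e"
    if "filterlim k at_top sequentially" for k R e
    using eventually_compose_filterlim[OF esc that] eventually_compose_filterlim[OF van that]
    by auto
  show "hatC2_normal X (range (\<lambda>n. F ^^ n))"
    unfolding hatC2_normal_def
  proof (intro allI impI)
    fix \<phi> :: "nat \<Rightarrow> complex \<times> complex \<Rightarrow> complex \<times> complex"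
    assume "range \<phi> \<subseteq> range (\<lambda>n. F ^^ n)"
    then obtain k where k: "\<And>i. \<phi> i = F ^^ (k i)" using iterates by blast
    show "diverges_on_compacts X \<phi> \<or>
        (\<exists>r f. strict_mono (r :: nat \<Rightarrow> nat) \<and>
               (fst \<circ> f) holomorphic2_on X \<and> (snd \<circ> f) holomorphic2_on X \<and>
               converges_on_compacts X (\<lambda>n. \<phi> (r n)) f)"
    proof (cases rule: nat_seq_at_top_or_constant_subseq[of k])
      case 1
      have "\<forall>\<^sub>F i in sequentially. \<forall>x\<in>K. norm (\<phi> i x) > R" if "K \<subseteq> X" for K R
      proof (rule eventually_mono[OF esc_seq[OF 1, of R]])
        fix i assume *: "\<forall>x\<in>X. R < cmod (fst ((F ^^ k i) x))"
        show "\<forall>x\<in>K. norm (\<phi> i x) > R"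
        proof
          fix x assume "x \<in> K"
          then have "R < cmod (fst (\<phi> i x))" using * k that by auto
          also have "\<dots> \<le> norm (\<phi> i x)" by (metis norm_fst_le prod.collapse)
          finally show "norm (\<phi> i x) > R" .
        qed
      qed
      then show ?thesis by (simp add: diverges_on_compacts_def)
    next
      case (2 m r)
      have "(\<lambda>n. \<phi> (r n)) = (\<lambda>_. F ^^ m)" using 2 k by auto
      then show ?thesis
        using 2 holn const_conv
        by (intro disjI2 exI[of _ r] exI[of _ "F ^^ m"]) (simp add: o_def)
    qed
  qed
  show "P2_normal X (range (\<lambda>n. F ^^ n))"
    unfolding P2_normal_def
  proof (intro allI impI)
    fix \<phi> :: "nat \<Rightarrow> complex \<times> complex \<Rightarrow> complex \<times> complex"
    assume "range \<phi> \<subseteq> range (\<lambda>n. F ^^ n)"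
    then obtain k where k: "\<And>i. \<phi> i = F ^^ (k i)" using iterates by blast
    show "\<exists>r f. strict_mono (r :: nat \<Rightarrow> nat) \<and> f holomorphic_cproj_on X \<and>
               converges_on_compacts X (\<lambda>n. to_P2 \<circ> \<phi> (r n)) f"
    proof (cases rule: nat_seq_at_top_or_constant_subseq[of k])
      case 1
      have "uniform_limit K (\<lambda>n. to_P2 \<circ> \<phi> (id n)) (\<lambda>_. P2_horizontal_infinity) sequentially"
        if "K \<subseteq> X" for K
      proof (rule uniform_limitI)
        fix e :: real assume "e > 0"
        then obtain R d where Rd: "d > 0" "\<And>z w. cmod z > R \<Longrightarrow> cmod w < d \<Longrightarrow>
            dist (to_P2 (z, w)) P2_horizontal_infinity < e"
          using to_P2_near_infinity by metis
        show "\<forall>\<^sub>F n in sequentially. \<forall>x\<in>K. dist ((to_P2 \<circ> \<phi> (id n)) x) P2_horizontal_infinity < e"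
          using esc_seq[OF 1, of R] van_seq[OF 1 Rd(1)]
        proof eventually_elim
          case (elim n)
          show ?case
          proof
            fix x assume "x \<in> K"
            then have "dist (to_P2 (fst (\<phi> n x), snd (\<phi> n x))) P2_horizontal_infinity < e"
              using elim that k by (intro Rd(2)) auto
            then show "dist ((to_P2 \<circ> \<phi> (id n)) x) P2_horizontal_infinity < e" by simp
          qed
        qed
      qed
      moreover have "(\<lambda>_. P2_horizontal_infinity) holomorphic_cproj_on X"
        unfolding P2_horizontal_infinity_def
        by (rule holomorphic_cproj_on_const) (simp add: vector3_nonzero)
      ultimately show ?thesis
        unfolding converges_on_compacts_def
        by (intro exI[of _ id] exI[of _ "\<lambda>_. P2_horizontal_infinity"]) (simp add: strict_mono_id)
    next
      case (2 m r)
      have "(to_P2 \<circ> F ^^ m) =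
          (\<lambda>x. abs_cproj (vector [fst ((F ^^ m) x), snd ((F ^^ m) x), 1]))"
        by (auto simp: to_P2_def fun_eq_iff case_prod_beta)
      moreover have "\<dots> holomorphic_cproj_on X"
      proof (intro holomorphic_cproj_on_abs vector3_nonzero)
        fix i :: 3
        show "(\<lambda>x. (vector [fst ((F ^^ m) x), snd ((F ^^ m) x), 1] :: complex ^ 3) $ i)
            holomorphic2_on X"
          using exhaust_3[of i] holn by (auto intro: holomorphic2_on_const)
      qed
      ultimately show ?thesis using 2 const_conv
        by (intro exI[of _ r] exI[of _ "to_P2 \<circ> F ^^ m"]) (simp add: k)
    qed
  qed
  show "sphere2_normal X (range (\<lambda>n. F ^^ n))"
    unfolding sphere2_normal_def
  proof (intro allI impI)
    fix \<phi> :: "nat \<Rightarrow> complex \<times> complex \<Rightarrow> complex \<times> complex"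
    assume "range \<phi> \<subseteq> range (\<lambda>n. F ^^ n)"
    then obtain k where k: "\<And>i. \<phi> i = F ^^ (k i)" using iterates by blast
    show "\<exists>r f. strict_mono (r :: nat \<Rightarrow> nat) \<and>
               (fst \<circ> f) holomorphic_cproj_on X \<and> (snd \<circ> f) holomorphic_cproj_on X \<and>
               converges_on_compacts X (\<lambda>n. to_sphere2 \<circ> \<phi> (r n)) f"
    proof (cases rule: nat_seq_at_top_or_constant_subseq[of k])
      case 1
      let ?f = "\<lambda>_ :: complex \<times> complex. (sphere_infinity, to_sphere 0)"
      have "uniform_limit K (\<lambda>n. to_sphere2 \<circ> \<phi> (id n)) ?f sequentially"
        if "K \<subseteq> X" for K
      proof (rule uniform_limitI)
        fix e :: real assume "e > 0"
        then obtain R where R: "\<And>z. cmod z > R \<Longrightarrow> dist (to_sphere z) sphere_infinity < e / 2"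
          using to_sphere_near_infinity[of "e / 2"] by auto
        obtain d where d: "d > 0" "\<And>w. cmod w < d \<Longrightarrow> dist (to_sphere w) (to_sphere 0) < e / 2"
          using continuous_on_to_sphere[of UNIV] half_gt_zero[OF \<open>e > 0\<close>]
          unfolding continuous_on_iff by (metis UNIV_I dist_0_norm dist_commute)
        show "\<forall>\<^sub>F n in sequentially. \<forall>x\<in>K. dist ((to_sphere2 \<circ> \<phi> (id n)) x) (sphere_infinity, to_sphere 0) < e"
          using esc_seq[OF 1, of R] van_seq[OF 1 d(1)]
        proof eventually_elim
          case (elim n)
          show ?case
          proof
            fix x assume "x \<in> K"
            let ?z = "fst (\<phi> n x)" and ?w = "snd (\<phi> n x)"
            have "(to_sphere2 \<circ> \<phi> (id n)) x = (to_sphere ?z, to_sphere ?w)"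
              by (simp add: to_sphere2_def case_prod_beta)
            moreover have "dist (to_sphere ?z, to_sphere ?w) (sphere_infinity, to_sphere 0) \<le>
                dist (to_sphere ?z) sphere_infinity + dist (to_sphere ?w) (to_sphere 0)"
              by (simp add: dist_Pair_Pair sqrt_sum_squares_le_sum)
            moreover have "dist (to_sphere ?z) sphere_infinity < e / 2"
              using R elim \<open>x \<in> K\<close> that k by auto
            moreover have "dist (to_sphere ?w) (to_sphere 0) < e / 2"
              using d(2) elim \<open>x \<in> K\<close> that k by auto
            ultimately show "dist ((to_sphere2 \<circ> \<phi> (id n)) x) (sphere_infinity, to_sphere 0) < e"
              by simp
          qed
        qed
      qed
      moreover have "(fst \<circ> ?f) holomorphic_cproj_on X" "(snd \<circ> ?f) holomorphic_cproj_on X"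
        unfolding sphere_infinity_def to_sphere_def o_def fst_conv snd_conv
        by (auto intro!: holomorphic_cproj_on_const simp: vector2_nonzero)
      ultimately show ?thesis
        unfolding converges_on_compacts_def
        by (intro exI[of _ id] exI[of _ ?f]) (simp add: strict_mono_id)
    next
      case (2 m r)
      have sphere: "(\<lambda>x. to_sphere (u x)) holomorphic_cproj_on X"
        if "u holomorphic2_on X" for u
        unfolding to_sphere_def
      proof (intro holomorphic_cproj_on_abs vector2_nonzero)
        fix i :: 2
        show "(\<lambda>x. (vector [u x, 1] :: complex ^ 2) $ i) holomorphic2_on X"
          using exhaust_2[of i] that by (auto intro: holomorphic2_on_const)
      qed
      have "fst \<circ> (to_sphere2 \<circ> F ^^ m) = (\<lambda>x. to_sphere (fst ((F ^^ m) x)))"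
        "snd \<circ> (to_sphere2 \<circ> F ^^ m) = (\<lambda>x. to_sphere (snd ((F ^^ m) x)))"
        by (auto simp: to_sphere2_def fun_eq_iff case_prod_beta)
      with 2 const_conv sphere[OF holn(1)] sphere[OF holn(2)] show ?thesis
        by (intro exI[of _ r] exI[of _ "to_sphere2 \<circ> F ^^ m"]) (simp add: k)
    qed
  qed
qed

section \<open>Normal iterates in one variable\<close>

lemma converges_on_compacts_tendsto:
  assumes "converges_on_compacts X \<phi> f" "x \<in> X"
  shows "(\<lambda>n. \<phi> n x) \<longlonglongrightarrow> f x"
proof -
  have "compact {x} \<and> {x} \<subseteq> X" using assms(2) by simp
  then have "uniform_limit {x} \<phi> f sequentially"
    using assms(1) unfolding converges_on_compacts_def by blast
  then show ?thesis by simp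
qed

lemma to_sphere_tendsto_infinity:
  assumes "filterlim u at_infinity F"
  shows "((\<lambda>k. to_sphere (u k)) \<longlongrightarrow> sphere_infinity) F"
proof (rule tendstoI)
  fix e :: real assume "e > 0"
  then obtain R where R: "\<And>z. cmod z > R \<Longrightarrow> dist (to_sphere z) sphere_infinity < e"
    using to_sphere_near_infinity by metis
  have "\<forall>\<^sub>F k in F. max R 0 + 1 \<le> norm (u k)"
    using assms unfolding filterlim_at_infinity[OF order_refl] by auto
  then show "\<forall>\<^sub>F k in F. dist (to_sphere (u k)) sphere_infinity < e"
    by eventually_elim (rule R, linarith)
qed

lemma norm_gt_if_to_sphere_near_infinity:
  assumes "dist (to_sphere z) sphere_infinity < 1 / (1 + R\<^sup>2)" "R \<ge> 0"
  shows "cmod z > R"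
proof -
  have "1 / (1 + (cmod z)\<^sup>2) < 1 / (1 + R\<^sup>2)"
    using assms(1) dist_to_sphere_infinity_ge[of z] by linarith
  moreover have "1 + (cmod z)\<^sup>2 > 0" "1 + R\<^sup>2 > 0" by (auto intro: add_pos_nonneg)
  ultimately have "R\<^sup>2 < (cmod z)\<^sup>2" by (simp add: field_simps)
  then show ?thesis by (rule power_less_imp_less_base) simp
qed

lemma filterlim_at_infinity_if_to_sphere_tendsto:
  assumes "((\<lambda>k. to_sphere (u k)) \<longlongrightarrow> sphere_infinity) F"
  shows "filterlim u at_infinity F"
  unfolding filterlim_at_infinity[OF order_refl]
proof (intro allI impI)
  fix R :: real assume "R > 0"
  have "1 + R\<^sup>2 > 0" by (auto intro: add_pos_nonneg)
  then have "\<forall>\<^sub>F k in F. dist (to_sphere (u k)) sphere_infinity < 1 / (1 + R\<^sup>2)"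
    by (intro tendstoD[OF assms]) simp
  then show "\<forall>\<^sub>F k in F. R \<le> norm (u k)"
    by eventually_elim (use norm_gt_if_to_sphere_near_infinity \<open>R > 0\<close> in fastforce)
qed

text \<open>
  Near a boundary point of the set where the limit is infinite, the reciprocals are bounded, so
  the identity theorem applies to a limit of them.
\<close>
lemma sphere_limit_infinite:
  assumes D: "open D" "connected D"
    and hol: "\<And>k :: nat. \<phi> k holomorphic_on D"
    and lim: "converges_on_compacts D (\<lambda>k. to_sphere \<circ> \<phi> k) G"
    and W: "open W" "W \<noteq> {}" "W \<subseteq> D" "\<And>x. x \<in> W \<Longrightarrow> G x = sphere_infinity"
    and x: "x \<in> D"
  shows "G x = sphere_infinity"
proof -
  let ?S = "interior {x \<in> D. G x = sphere_infinity}"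
  have ptlim: "(\<lambda>k. to_sphere (\<phi> k y)) \<longlonglongrightarrow> G y" if "y \<in> D" for y
    using converges_on_compacts_tendsto[OF lim that] by simp
  \<comment> \<open>\<open>GPicard2\<close> is the connectedness argument: a nonempty open subset of
    \<open>D\<close> that contains all its limit points in \<open>D\<close> is all of
    \<open>D\<close>.\<close>
  have "?S = D"
  proof (rule GPicard2)
    show "?S \<subseteq> D" using interior_subset by blast
    have "W \<subseteq> ?S" using W by (intro interior_maximal) auto
    then show "?S \<noteq> {}" using W by auto
    fix x assume lx: "x islimpt ?S" and "x \<in> D"
    obtain e where e: "e > 0" "cball x e \<subseteq> D"
      using D(1) \<open>x \<in> D\<close> open_contains_cball by blast
    have ul: "uniform_limit (cball x e) (\<lambda>k. to_sphere \<circ> \<phi> k) G sequentially"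
      using lim e unfolding converges_on_compacts_def by auto
    have "continuous_on (cball x e) (to_sphere \<circ> \<phi> k)" for k
      using hol[of k] e
      by (intro continuous_on_compose continuous_on_to_sphere)
        (meson continuous_on_subset holomorphic_on_imp_continuous_on)
    then have contG: "continuous_on (cball x e) G"
      by (intro uniform_limit_theorem[OF _ ul]) auto
    have Gx: "G x = sphere_infinity"
    proof (rule ccontr)
      assume "G x \<noteq> sphere_infinity"
      then obtain d where d: "d > 0"
          "\<And>y. y \<in> cball x e \<Longrightarrow> dist y x < d \<Longrightarrow> dist (G y) (G x) < dist sphere_infinity (G x)"
        using contG e unfolding continuous_on_iff
        by (metis centre_in_cball less_imp_le zero_less_dist_iff)
      obtain y where "y \<in> ?S" "dist y x < min d e"
        using lx d e unfolding islimpt_approachable by (metis min_less_iff_conj)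
      then show False using d(2)[of y] interior_subset[of "{x \<in> D. G x = sphere_infinity}"]
        by (auto simp: dist_commute)
    qed
    \<comment> \<open>Two errors of 1/4 add up to less than 1/2, which is the spherical threshold
      \<open>1 / (1 + 1\<^sup>2)\<close> that forces modulus greater than 1.\<close>
    obtain d where d: "d > 0"
        "\<And>y. y \<in> cball x e \<Longrightarrow> dist y x < d \<Longrightarrow> dist (G y) (G x) < 1 / 4"
      using contG e unfolding continuous_on_iff
      by (metis centre_in_cball less_imp_le zero_less_divide_1_iff zero_less_numeral)
    obtain k0 where k0: "\<And>k y. k \<ge> k0 \<Longrightarrow> y \<in> cball x e \<Longrightarrow>
        dist (to_sphere (\<phi> k y)) (G y) < 1 / 4"
      using uniform_limitD[OF ul, of "1 / 4"] unfolding eventually_sequentially by force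
    define N where "N = ball x (min d e)"
    have N: "open N" "connected N" "N \<subseteq> D" "x \<in> N"
      using e d by (auto simp: N_def)
    have big: "cmod (\<phi> k y) > 1" if "k \<ge> k0" "y \<in> N" for k y
    proof (rule norm_gt_if_to_sphere_near_infinity)
      have "dist (G y) sphere_infinity < 1 / 4" "dist (to_sphere (\<phi> k y)) (G y) < 1 / 4"
        using that d(2)[of y] k0[of k y] Gx by (auto simp: N_def dist_commute)
      then show "dist (to_sphere (\<phi> k y)) sphere_infinity < 1 / (1 + 1\<^sup>2)"
        using dist_triangle[of "to_sphere (\<phi> k y)" sphere_infinity "G y"] by simp
    qed simp
    define \<psi> where "\<psi> = (\<lambda>k y. inverse (\<phi> (k + k0) y))"
    have nz: "\<phi> (k + k0) y \<noteq> 0" if "y \<in> N" for k y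
      using big[OF _ that, of "k + k0"] by auto
    have hol\<psi>: "\<psi> k holomorphic_on N" for k
      unfolding \<psi>_def using nz
      by (intro holomorphic_on_inverse) (auto intro: holomorphic_on_subset[OF hol N(3)])
    have bound\<psi>: "norm (\<psi> k y) \<le> 1" if "y \<in> N" for k y
      using big[OF _ that, of "k + k0"] by (simp add: \<psi>_def norm_inverse inverse_le_1_iff)
    \<comment> \<open>The reciprocals are holomorphic and bounded by 1 on \<open>N\<close>, so
      Montel's theorem provides a holomorphic limit, which vanishes on the open set
      \<open>N \<inter> ?S\<close>.\<close>
    obtain g r where g: "g holomorphic_on N" "strict_mono (r :: nat \<Rightarrow> nat)"
        "\<And>y. y \<in> N \<Longrightarrow> (\<lambda>n. \<psi> (r n) y) \<longlonglongrightarrow> g y"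
    proof (rule Montel[of N "range \<psi>" \<psi>])
      show "\<exists>B. \<forall>h\<in>range \<psi>. \<forall>z\<in>K. norm (h z) \<le> B" if "K \<subseteq> N" for K
        using bound\<psi> that by (intro exI[of _ 1]) auto
    qed (use N hol\<psi> in auto)
    have sub: "filterlim (\<lambda>n. r n + k0) at_top sequentially"
      using filterlim_subseq[OF g(2)] filterlim_add_const_nat_at_top filterlim_compose by blast
    have sublim: "(\<lambda>n. to_sphere (\<phi> (r n + k0) y)) \<longlonglongrightarrow> G y" if "y \<in> N" for y
      using filterlim_compose[OF ptlim sub] that N by auto
    have "g y = 0" if "y \<in> N \<inter> ?S" for y
    proof -
      have "G y = sphere_infinity" using that interior_subset by blast
      then have "filterlim (\<lambda>n. \<phi> (r n + k0) y) at_infinity sequentially"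
        using sublim[of y] that by (intro filterlim_at_infinity_if_to_sphere_tendsto) auto
      then have "(\<lambda>n. \<psi> (r n) y) \<longlonglongrightarrow> 0"
        unfolding \<psi>_def by (rule tendsto_inverse_0[THEN filterlim_compose])
      then show ?thesis using g(3)[of y] that LIMSEQ_unique by blast
    qed
    moreover have "N \<inter> ?S \<noteq> {}"
      using lx N unfolding islimpt_def by blast
    ultimately have g0: "g y = 0" if "y \<in> N" for y
      using analytic_continuation_open[of "N \<inter> ?S" N g "\<lambda>_. 0" y] N g(1) that by auto
    have "G y = sphere_infinity" if "y \<in> N" for y
    proof -
      have "(\<lambda>n. inverse (\<phi> (r n + k0) y)) \<longlonglongrightarrow> 0" using g(3)[OF that] g0[OF that] by (simp add: \<psi>_def)
      then have "filterlim (\<lambda>n. \<phi> (r n + k0) y) at_infinity sequentially"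
        using nz[OF that]
        by (intro filterlim_inverse_at_iff[THEN iffD1]) (auto simp: filterlim_at)
      from to_sphere_tendsto_infinity[OF this] show ?thesis
        using sublim[OF that] LIMSEQ_unique by blast
    qed
    then show "x \<in> ?S" using N by (intro interiorI[of N]) auto
  qed (use D in auto)
  then show ?thesis using x interior_subset by blast
qed

lemma holomorphic_on_funpow:
  "u holomorphic_on UNIV \<Longrightarrow> (u ^^ n) holomorphic_on UNIV"
  by (induction n) (auto simp: id_def intro: holomorphic_on_compose holomorphic_on_subset)

text \<open>Otherwise infinitely many iterates take a value of modulus at most \<open>R\<close> on
  \<open>K\<close>. A subsequence of these converges on the sphere; its limit is infinite on
  \<open>W\<close>, hence on \<open>D\<close> by \<open>sphere_limit_infinite\<close>, and uniform
  convergence on \<open>K\<close> gives a contradiction.\<close>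

lemma normal_iterates_escape_uniformly:
  assumes f: "f holomorphic_on UNIV"
    and normal: "sphere_normal X (range (\<lambda>n. f ^^ n))"
    and D: "open D" "connected D" "D \<subseteq> X"
    and W: "open W" "W \<noteq> {}" "W \<subseteq> D"
      "\<And>x. x \<in> W \<Longrightarrow> filterlim (\<lambda>n. (f ^^ n) x) at_infinity sequentially"
    and K: "compact K" "K \<subseteq> D"
  shows "\<forall>\<^sub>F n in sequentially. \<forall>x\<in>K. cmod ((f ^^ n) x) > R"
proof (rule ccontr)
  assume neg: "\<not> ?thesis"
  let ?I = "{n. \<exists>x\<in>K. cmod ((f ^^ n) x) \<le> R}"
  have "infinite ?I"
    using neg unfolding eventually_cofinite[symmetric] cofinite_eq_sequentially[symmetric]
    by (simp add: eventually_cofinite not_less)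
  then have s: "strict_mono (enumerate ?I)" "\<And>k. enumerate ?I k \<in> ?I"
    by (auto intro: strict_mono_enumerate dest: enumerate_in_set)
  define s where "s = enumerate ?I"
  have "range (\<lambda>k. f ^^ s k) \<subseteq> range (\<lambda>n. f ^^ n)" by auto
  then obtain r G where r: "strict_mono (r :: nat \<Rightarrow> nat)"
      and G: "converges_on_compacts X (\<lambda>n. to_sphere \<circ> (f ^^ s (r n))) G"
    using normal unfolding sphere_normal_def by blast
  have sr: "filterlim (\<lambda>n. s (r n)) at_top sequentially"
    using s(1) r unfolding s_def by (intro filterlim_subseq) (auto simp: strict_mono_def)
  have GD: "converges_on_compacts D (\<lambda>n. to_sphere \<circ> (f ^^ s (r n))) G"
    using G D unfolding converges_on_compacts_def by auto
  have GW: "G x = sphere_infinity" if "x \<in> W" for x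
  proof -
    have "(\<lambda>n. to_sphere ((f ^^ s (r n)) x)) \<longlonglongrightarrow> G x"
      using converges_on_compacts_tendsto[OF GD, of x] that W by auto
    moreover have "(\<lambda>n. to_sphere ((f ^^ s (r n)) x)) \<longlonglongrightarrow> sphere_infinity"
      by (intro to_sphere_tendsto_infinity filterlim_compose[OF W(4)[OF that] sr])
    ultimately show ?thesis by (rule LIMSEQ_unique)
  qed
  have "(f ^^ s (r k)) holomorphic_on D" for k
    using holomorphic_on_funpow[OF f] holomorphic_on_subset by blast
  note inf = sphere_limit_infinite[OF D(1,2) this GD W(1-3) GW]
  have "uniform_limit K (\<lambda>n. to_sphere \<circ> (f ^^ s (r n))) G sequentially"
    using GD K unfolding converges_on_compacts_def by auto
  \<comment> \<open>Spherical distance to infinity below this tolerance means modulus above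
    \<open>max R 0\<close>; the maximum covers negative \<open>R\<close>.\<close>
  moreover have "1 / (1 + (max R 0)\<^sup>2) > 0" by (auto intro!: divide_pos_pos add_pos_nonneg)
  ultimately have "\<forall>\<^sub>F n in sequentially. \<forall>x\<in>K.
      dist ((to_sphere \<circ> (f ^^ s (r n))) x) (G x) < 1 / (1 + (max R 0)\<^sup>2)"
    by (rule uniform_limitD)
  then obtain n where n: "\<And>x. x \<in> K \<Longrightarrow>
      dist (to_sphere ((f ^^ s (r n)) x)) (G x) < 1 / (1 + (max R 0)\<^sup>2)"
    by (auto simp: eventually_sequentially)
  obtain x where x: "x \<in> K" "cmod ((f ^^ s (r n)) x) \<le> R"
    using s(2)[of "r n"] by (auto simp: s_def)
  have "cmod ((f ^^ s (r n)) x) > max R 0"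
    using n[OF x(1)] inf[of x] x(1) K by (intro norm_gt_if_to_sphere_near_infinity) auto
  with x(2) show False by simp
qed

text \<open>The difference quotient at \<open>c\<close> tends to the derivative. The constant
  \<open>\<mu>\<close> may exceed 1, so that the same estimate bounds \<open>deriv g\<close>
  linearly in the superattracting case.\<close>

lemma attracting_contraction:
  assumes "u holomorphic_on UNIV" "u c = c" "cmod (deriv u c) < \<mu>"
  obtains s where "s > 0" "\<And>z. dist z c \<le> s \<Longrightarrow> dist (u z) c \<le> \<mu> * dist z c"
proof -
  have "(u has_field_derivative deriv u c) (at c)"
    using assms(1) by (simp add: holomorphic_derivI)
  then have "(\<lambda>z. cmod ((u z - c) / (z - c))) \<midarrow>c\<rightarrow> cmod (deriv u c)"
    unfolding has_field_derivative_iff by (simp add: assms(2) tendsto_norm)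
  from order_tendstoD(2)[OF this assms(3)] obtain d where d: "d > 0"
      "\<And>z. z \<noteq> c \<Longrightarrow> dist z c < d \<Longrightarrow> cmod ((u z - c) / (z - c)) < \<mu>"
    unfolding eventually_at by auto
  show thesis
  proof (rule that[of "d / 2"])
    fix z assume z: "dist z c \<le> d / 2"
    show "dist (u z) c \<le> \<mu> * dist z c"
    proof (cases "z = c")
      case False
      then have "cmod (u z - c) / cmod (z - c) < \<mu>"
        using d z by (auto simp: norm_divide)
      then show ?thesis using False by (simp add: dist_norm divide_less_eq)
    qed (use assms in simp)
  qed (use d in simp)
qed

lemma contraction_funpow:
  assumes "\<And>z. dist z c \<le> s \<Longrightarrow> dist (u z) c \<le> \<mu> * dist z c"
    and "0 \<le> \<mu>" "\<mu> < 1" and "dist z c \<le> s"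
  shows "dist ((u ^^ n) z) c \<le> \<mu> ^ n * dist z c"
proof (induction n)
  case (Suc n)
  have "\<mu> ^ n * dist z c \<le> 1 * dist z c"
    using assms by (intro mult_right_mono power_le_one) auto
  then have "dist (u ((u ^^ n) z)) c \<le> \<mu> * dist ((u ^^ n) z) c"
    using Suc assms by (intro assms(1)) linarith
  also have "\<dots> \<le> \<mu> * (\<mu> ^ n * dist z c)" using Suc assms by (intro mult_left_mono)
  finally show ?case by (simp add: mult.assoc)
qed simp

section \<open>The Fatou component lies in the basin\<close>

definition attraction_basin :: "(complex \<Rightarrow> complex) \<Rightarrow> complex \<Rightarrow> complex set" where
  "attraction_basin u c = {z. (\<lambda>n. (u ^^ n) z) \<longlonglongrightarrow> c}"

text \<open>An orbit that enters the contracted disc converges geometrically to \<open>c\<close>.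
  The basin is thus a union of preimages of one disc, and a single late iterate decides
  membership.\<close>

lemma attraction_basin_iff:
  assumes contr: "\<And>z. dist z c \<le> s \<Longrightarrow> dist (u z) c \<le> \<mu> * dist z c"
    and "0 \<le> \<mu>" "\<mu> < 1" "0 < s"
  shows "z \<in> attraction_basin u c \<longleftrightarrow> (\<exists>n. dist ((u ^^ n) z) c < s)"
proof
  assume "z \<in> attraction_basin u c"
  then have "(\<lambda>n. (u ^^ n) z) \<longlonglongrightarrow> c" by (simp add: attraction_basin_def)
  from tendstoD[OF this \<open>0 < s\<close>] show "\<exists>n. dist ((u ^^ n) z) c < s"
    by (auto simp: eventually_sequentially)
next
  assume "\<exists>n. dist ((u ^^ n) z) c < s"
  then obtain n where n: "dist ((u ^^ n) z) c \<le> s" by (auto intro: less_imp_le)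
  have "(\<lambda>k. \<mu> ^ k * dist ((u ^^ n) z) c) \<longlonglongrightarrow> 0"
    using assms by (intro tendsto_mult_left_zero LIMSEQ_realpow_zero)
  then have "(\<lambda>k. (u ^^ k) ((u ^^ n) z)) \<longlonglongrightarrow> c"
  proof (rule metric_tendsto_imp_tendsto)
    show "\<forall>\<^sub>F k in sequentially. dist ((u ^^ k) ((u ^^ n) z)) c \<le> dist (\<mu> ^ k * dist ((u ^^ n) z) c) 0"
    proof (intro always_eventually allI)
      fix k
      have "dist ((u ^^ k) ((u ^^ n) z)) c \<le> \<mu> ^ k * dist ((u ^^ n) z) c"
        by (rule contraction_funpow[OF contr assms(2,3) n])
      then show "dist ((u ^^ k) ((u ^^ n) z)) c \<le> dist (\<mu> ^ k * dist ((u ^^ n) z) c) 0"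
        by (simp add: dist_norm)
    qed
  qed
  then have "(\<lambda>k. (u ^^ (k + n)) z) \<longlonglongrightarrow> c" by (simp add: funpow_add)
  then show "z \<in> attraction_basin u c"
    unfolding attraction_basin_def by (simp add: LIMSEQ_offset)
qed

lemma open_attraction_basin:
  assumes "u holomorphic_on UNIV" "attracting_fixed_point u c"
  shows "open (attraction_basin u c)"
proof -
  obtain \<mu> where \<mu>: "cmod (deriv u c) < \<mu>" "\<mu> < 1"
    using assms(2) dense unfolding attracting_fixed_point_def by blast
  then have "0 \<le> \<mu>" by (meson norm_ge_zero less_imp_le order.trans)
  obtain s where s: "s > 0" "\<And>z. dist z c \<le> s \<Longrightarrow> dist (u z) c \<le> \<mu> * dist z c"
    using attracting_contraction[OF assms(1) _ \<mu>(1)] assms(2)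
    unfolding attracting_fixed_point_def by metis
  have "attraction_basin u c = (\<Union>n. (u ^^ n) -` ball c s)"
    using attraction_basin_iff[OF s(2) \<open>0 \<le> \<mu>\<close> \<mu>(2) s(1)] by (auto simp: dist_commute)
  moreover have "open ((u ^^ n) -` ball c s)" for n
    by (intro open_vimage holomorphic_on_imp_continuous_on holomorphic_on_funpow assms(1)) simp
  ultimately show ?thesis by auto
qed

section \<open>Periodicity and omitted values of escaping iterates\<close>

lemma periodic_of_nat:
  fixes p :: "complex \<Rightarrow> complex"
  assumes "\<And>z. p (z + T) = p z"
  shows "p (z + of_nat k * T) = p z"
proof (induction k)
  case (Suc k)
  have "z + of_nat (Suc k) * T = (z + of_nat k * T) + T" by (simp add: algebra_simps)
  then have "p (z + of_nat (Suc k) * T) = p (z + of_nat k * T)" by (simp only: assms)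
  then show ?case by (simp only: Suc)
qed simp

text \<open>By periodicity \<open>z + p z\<close> commutes with translation by \<open>T\<close>, so
  the translations can be collected at the end.\<close>

lemma translated_funpow:
  fixes p :: "complex \<Rightarrow> complex"
  assumes "\<And>z. p (z + T) = p z"
  shows "((\<lambda>z. z + T + p z) ^^ n) z = ((\<lambda>z. z + p z) ^^ n) z + of_nat n * T"
proof (induction n)
  case (Suc n)
  have "p (((\<lambda>z. z + p z) ^^ n) z + of_nat n * T) = p (((\<lambda>z. z + p z) ^^ n) z)"
    by (rule periodic_of_nat[of p T, OF assms])
  then show ?case by (simp add: Suc) (simp add: algebra_simps)
qed simp

text \<open>
  The points \<open>c + j T\<close> with \<open>p c = - m T\<close> and \<open>m \<in> {1, 2}\<close> are fixed by \<open>f\<close> or are moved by \<open>- T\<close>,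
  so for \<open>j \<ge> 0\<close> their orbits do not stay far out, and late iterates of escaping points omit them.
\<close>
lemma escaping_omit_translates:
  fixes p :: "complex \<Rightarrow> complex"
  assumes per: "\<And>z. p (z + T) = p z" and c: "p c = - T \<or> p c = - (2 * T)"
    and f: "f = (\<lambda>z. z + T + p z)"
    and esc: "\<And>R. \<forall>\<^sub>F n in sequentially. \<forall>x\<in>K. cmod ((f ^^ n) x) > R"
  obtains n0 where "\<And>n x j. n \<ge> n0 \<Longrightarrow> x \<in> K \<Longrightarrow> (f ^^ n) x \<noteq> c + of_nat j * T"
proof -
  \<comment> \<open>The threshold depends on \<open>cmod c\<close> alone and therefore serves all
    \<open>j\<close>. The bound involving \<open>j\<close> in the first case below only concerns
    later iterates of the same orbit.\<close>
  obtain n0 where n0: "\<And>n x. n \<ge> n0 \<Longrightarrow> x \<in> K \<Longrightarrow> cmod ((f ^^ n) x) > cmod c"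
    using esc[of "cmod c"] unfolding eventually_sequentially by blast
  have pj: "p (c + of_nat j * T) = p c" for j by (rule periodic_of_nat[of p T, OF per])
  have "(f ^^ n) x \<noteq> c + of_nat j * T" if "n \<ge> n0" "x \<in> K" for n x j
  proof
    assume eq: "(f ^^ n) x = c + of_nat j * T"
    show False
      using c
    proof
      assume "p c = - T"
      then have "f (c + of_nat j * T) = c + of_nat j * T" using pj by (simp add: f)
      then have "(f ^^ k) (c + of_nat j * T) = c + of_nat j * T" for k by (induction k) auto
      then have "(f ^^ (k + n)) x = c + of_nat j * T" for k by (simp add: funpow_add eq)
      moreover obtain n1 where "\<And>n. n \<ge> n1 \<Longrightarrow> cmod ((f ^^ n) x) > cmod (c + of_nat j * T)"
        using esc[of "cmod (c + of_nat j * T)"] \<open>x \<in> K\<close> unfolding eventually_sequentially by blast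
      ultimately show False by (metis le_add1 less_irrefl)
    next
      assume "p c = - (2 * T)"
      then have step: "f (c + of_nat (Suc i) * T) = c + of_nat i * T" for i
        using pj[of "Suc i"] by (simp add: f algebra_simps)
      have "(f ^^ k) (c + of_nat k * T) = c" for k
        by (induction k) (simp_all only: funpow_Suc_right o_def step, simp_all)
      then have "(f ^^ (j + n)) x = c" by (simp add: funpow_add eq)
      then show False using n0[of "j + n" x] that by simp
    qed
  qed
  then show thesis using that by blast
qed

text \<open>Normalized affinely, the late iterates omit 0 and 1 and are bounded at \<open>w\<close>.
  The Schottky bound \<open>GPicard3\<close> makes them locally bounded, and Montel's theorem gives
  a holomorphic limit of a subsequence. It is constant near \<open>w\<close>, hence on
  \<open>D\<close>, so every orbit from \<open>D\<close> comes close to \<open>z0\<close>.\<close>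

lemma omitted_values_extend_basin:
  assumes u: "u holomorphic_on UNIV" "attracting_fixed_point u z0" and "T \<noteq> 0"
    and D: "open D" "connected D" "w \<in> D \<inter> attraction_basin u z0"
    and omit: "\<And>n x j. n \<ge> n0 \<Longrightarrow> x \<in> D \<Longrightarrow> (u ^^ n) x \<noteq> c + of_nat j * T"
  shows "D \<subseteq> attraction_basin u z0"
proof
  fix b assume "b \<in> D"
  obtain \<mu> where \<mu>: "cmod (deriv u z0) < \<mu>" "\<mu> < 1"
    using u(2) dense unfolding attracting_fixed_point_def by blast
  then have "0 \<le> \<mu>" by (meson norm_ge_zero less_imp_le order.trans)
  obtain s where s: "s > 0" "\<And>z. dist z z0 \<le> s \<Longrightarrow> dist (u z) z0 \<le> \<mu> * dist z z0"
    using attracting_contraction[OF u(1) _ \<mu>(1)] u(2) unfolding attracting_fixed_point_def by metis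
  note basin = attraction_basin_iff[OF s(2) \<open>0 \<le> \<mu>\<close> \<mu>(2) s(1)]
  have "(\<lambda>n. (u ^^ n) w) \<longlonglongrightarrow> z0" using D by (simp add: attraction_basin_def)
  then obtain n1 where n1: "\<And>n. n \<ge> n1 \<Longrightarrow> dist ((u ^^ n) w) z0 < 1"
    using tendstoD[of _ z0 sequentially 1] by (auto simp: eventually_sequentially)
  \<comment> \<open>The omitted values \<open>c\<close> and \<open>c + M T\<close> are taken so far
    apart that dividing by \<open>M T\<close> brings the values at \<open>w\<close> into the unit
    disc, as \<open>GPicard3\<close> demands.\<close>
  obtain M :: nat where M: "(1 + dist z0 c) / cmod T < real M" using reals_Archimedean2 by blast
  have "0 \<le> (1 + dist z0 c) / cmod T" by simp
  then have "0 < real M" using M by linarith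
  then have Mpos: "M > 0" by simp
  define X where "X = {\<lambda>z. ((u ^^ n) z - c) / (of_nat M * T) | n. n \<ge> max n0 n1}"
  define \<psi> where "\<psi> = (\<lambda>n z. ((u ^^ (n + max n0 n1)) z - c) / (of_nat M * T))"
  have nz: "of_nat M * T \<noteq> 0" using Mpos \<open>T \<noteq> 0\<close> by simp
  have holX: "h holomorphic_on D" if "h \<in> X" for h
    using that nz holomorphic_on_subset[OF holomorphic_on_funpow[OF u(1)], of D]
    unfolding X_def by (auto intro!: holomorphic_intros)
  have X01: "h z \<noteq> 0 \<and> h z \<noteq> 1" if "h \<in> X" "z \<in> D" for h z
  proof -
    obtain n where n: "n \<ge> n0" "h = (\<lambda>z. ((u ^^ n) z - c) / (of_nat M * T))"
      using \<open>h \<in> X\<close> unfolding X_def by auto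
    show ?thesis
      using omit[OF n(1) \<open>z \<in> D\<close>, of 0] omit[OF n(1) \<open>z \<in> D\<close>, of M] nz
      by (auto simp: n(2) divide_eq_1_iff diff_eq_eq add.commute)
  qed
  have Xw: "norm (h w) \<le> 1" if "h \<in> X" for h
  proof -
    obtain n where n: "n \<ge> n1" "h = (\<lambda>z. ((u ^^ n) z - c) / (of_nat M * T))"
      using \<open>h \<in> X\<close> unfolding X_def by auto
    have "dist ((u ^^ n) w) c \<le> 1 + dist z0 c"
      using n1[OF n(1)] dist_triangle[of "(u ^^ n) w" c z0] by linarith
    also have "\<dots> \<le> real M * cmod T" using M \<open>T \<noteq> 0\<close> by (simp add: field_simps)
    finally show ?thesis using nz by (simp add: n(2) norm_divide norm_mult dist_norm divide_le_eq)
  qed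
  obtain g r where g: "g holomorphic_on D" "strict_mono (r :: nat \<Rightarrow> nat)"
      "\<And>y. y \<in> D \<Longrightarrow> (\<lambda>n. \<psi> (r n) y) \<longlonglongrightarrow> g y"
  proof (rule Montel[of D X \<psi>])
    show "\<exists>B. \<forall>h\<in>X. \<forall>z\<in>K. norm (h z) \<le> B" if "compact K" "K \<subseteq> D" for K
    proof (rule GPicard3[of D w X X K])
      show "\<exists>B. \<forall>h\<in>X. \<forall>z\<in>K. norm (h z) \<le> B"
        if "\<And>h z. h \<in> X \<Longrightarrow> z \<in> K \<Longrightarrow> norm (h z) \<le> B" for B
        using that by blast
    qed (use D holX X01 Xw that in auto)
    show "range \<psi> \<subseteq> X" by (auto simp: \<psi>_def X_def)
  qed (use D holX in auto)
  define N where "N = D \<inter> attraction_basin u z0"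
  have N: "open N" "N \<noteq> {}" "N \<subseteq> D"
    using D open_attraction_basin[OF u] by (auto simp: N_def)
  have "g y = (z0 - c) / (of_nat M * T)" if "y \<in> N" for y
  proof -
    have "(\<lambda>n. (u ^^ n) y) \<longlonglongrightarrow> z0" using that by (simp add: N_def attraction_basin_def)
    then have "(\<lambda>n. (u ^^ (n + max n0 n1)) y) \<longlonglongrightarrow> z0" by (rule LIMSEQ_ignore_initial_segment)
    then have "(\<lambda>n. \<psi> n y) \<longlonglongrightarrow> (z0 - c) / (of_nat M * T)"
      unfolding \<psi>_def using nz by (intro tendsto_intros)
    then have "(\<lambda>n. \<psi> (r n) y) \<longlonglongrightarrow> (z0 - c) / (of_nat M * T)"
      using filterlim_compose filterlim_subseq[OF g(2)] by blast
    then show ?thesis using g(3)[of y] that N LIMSEQ_unique by blast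
  qed
  then have "g b = (z0 - c) / (of_nat M * T)"
    using analytic_continuation_open[OF N(1) D(1) N(2) D(2) N(3) g(1), of "\<lambda>_. (z0 - c) / (of_nat M * T)" b]
      \<open>b \<in> D\<close> by auto
  then have "(\<lambda>n. \<psi> (r n) b) \<longlonglongrightarrow> (z0 - c) / (of_nat M * T)" using g(3)[OF \<open>b \<in> D\<close>] by simp
  then have "(\<lambda>n. \<psi> (r n) b * (of_nat M * T) + c) \<longlonglongrightarrow> (z0 - c) / (of_nat M * T) * (of_nat M * T) + c"
    by (intro tendsto_intros)
  then have "(\<lambda>n. (u ^^ (r n + max n0 n1)) b) \<longlonglongrightarrow> z0" using nz by (simp add: \<psi>_def)
  from tendstoD[OF this s(1)] have "\<exists>n. dist ((u ^^ n) b) z0 < s"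
    by (auto simp: eventually_sequentially)
  then show "b \<in> attraction_basin u z0" using basin by blast
qed

text \<open>Points of the component in the closure of the open basin lie in the basin. The basin and
  the complement of its closure therefore cover the component, which is connected and, unless empty,
  meets the basin at \<open>z0\<close>.\<close>

lemma fatou_component_subset_basin:
  fixes p :: "complex \<Rightarrow> complex"
  assumes T: "T \<noteq> 0" and p: "p holomorphic_on UNIV" and per: "\<And>z. p (z + T) = p z"
    and attr: "attracting_fixed_point (\<lambda>z. z + p z) z0"
    and f_eq: "f = (\<lambda>z. z + T + p z)"
  shows "fatou_component f z0 \<subseteq> attraction_basin (\<lambda>z. z + p z) z0"
proof -
  define u where "u = (\<lambda>z. z + p z)"
  define U where "U = fatou_component f z0"
  let ?A = "attraction_basin u z0"
  have u: "u holomorphic_on UNIV" "attracting_fixed_point u z0"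
    using p attr by (auto simp: u_def intro!: holomorphic_intros)
  have f: "f holomorphic_on UNIV" unfolding f_eq using p by (intro holomorphic_intros)
  have fn: "(f ^^ n) z = (u ^^ n) z + of_nat n * T" for n z
    unfolding f_eq u_def by (rule translated_funpow[of p T, OF per])
  \<comment> \<open>By little Picard, \<open>p\<close> would otherwise be constant, and
    \<open>u\<close> would have derivative 1 at its attracting fixed point.\<close>
  have "range p \<inter> {- T, - (2 * T)} \<noteq> {}"
  proof
    assume "range p \<inter> {- T, - (2 * T)} = {}"
    then obtain a where "p = (\<lambda>_. a)"
      using little_Picard[OF p, of "- T" "- (2 * T)"] T by auto
    then have "deriv u z0 = 1" by (simp add: u_def)
    then show False using u(2) by (simp add: attracting_fixed_point_def)
  qed
  then obtain c where c: "p c = - T \<or> p c = - (2 * T)" by force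
  have esc: "filterlim (\<lambda>n. (f ^^ n) x) at_infinity sequentially" if "x \<in> ?A" for x
    unfolding fn
  proof (rule tendsto_add_filterlim_at_infinity)
    show "(\<lambda>n. (u ^^ n) x) \<longlonglongrightarrow> z0" using that by (simp add: attraction_basin_def)
    show "filterlim (\<lambda>n. of_nat n * T) at_infinity sequentially"
      using tendsto_mult_filterlim_at_infinity[OF tendsto_const T tendsto_of_nat]
      by (simp add: mult.commute)
  qed
  have local: "b \<in> ?A" if b: "b \<in> U" "b \<in> closure ?A" for b
  proof -
    have "b \<in> fatou_set sphere_normal f"
      using b(1) connected_component_subset unfolding U_def fatou_component_def by blast
    then obtain X where X: "open X" "b \<in> X" "sphere_normal X (range (\<lambda>n. f ^^ n))"
      unfolding fatou_set_def by blast
    obtain r where r: "r > 0" "ball b r \<subseteq> X" using X open_contains_ball by blast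
    let ?D = "ball b r" and ?D' = "ball b (r / 2)"
    have meets: "\<exists>y\<in>?A. dist y b < e" if "e > 0" for e
      using b(2) that by (simp add: closure_approachable)
    have W: "open (?D \<inter> ?A)" using open_attraction_basin[OF u] by auto
    have ne: "?D \<inter> ?A \<noteq> {}"
    proof -
      obtain y where "y \<in> ?A" "dist y b < r" using meets r by blast
      then have "y \<in> ?D \<inter> ?A" by (simp add: dist_commute)
      then show ?thesis by blast
    qed
    \<comment> \<open>Normality is used on the ball of radius \<open>r\<close>; the closed ball of
      half the radius is compact in it, and its interior is the domain for Montel's theorem.\<close>
    have escK: "\<forall>\<^sub>F n in sequentially. \<forall>x\<in>cball b (r / 2). cmod ((f ^^ n) x) > R" for R
      by (rule normal_iterates_escape_uniformly[OF f X(3) open_ball connected_ball r(2) W ne])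
        (use esc r in auto)
    obtain n0 where n0: "\<And>n x j. n \<ge> n0 \<Longrightarrow> x \<in> cball b (r / 2) \<Longrightarrow> (f ^^ n) x \<noteq> c + of_nat j * T"
      using escaping_omit_translates[of p T, OF per c f_eq escK] by blast
    obtain w where "w \<in> ?A" "dist w b < r / 2" using meets[of "r / 2"] r by auto
    then have w: "w \<in> ?D' \<inter> ?A" by (simp add: dist_commute)
    have "?D' \<subseteq> ?A"
    proof (rule omitted_values_extend_basin[OF u T open_ball connected_ball w, of n0 c])
      fix n x j assume "n0 \<le> n" "x \<in> ?D'"
      then show "(u ^^ n) x \<noteq> c + of_nat j * T"
        \<comment> \<open>A value \<open>c + j T\<close> of the n-th iterate of \<open>u\<close> is
          a value \<open>c + (j + n) T\<close> of that of \<open>f\<close>. The shift grows with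
          \<open>n\<close>, so all nonnegative translates have to be omitted.\<close>
        using n0[of n x "j + n"] fn[of n x] by (auto simp: algebra_simps)
    qed
    then show ?thesis using r by auto
  qed
  show ?thesis
  proof (cases "z0 \<in> U")
    case True
    have "connected U" by (simp add: U_def fatou_component_def)
    moreover have "open ?A" by (rule open_attraction_basin[OF u])
    moreover have "open (- closure ?A)" by (intro open_Compl closed_closure)
    moreover have "?A \<inter> - closure ?A \<inter> U = {}" using closure_subset by blast
    moreover have "U \<subseteq> ?A \<union> - closure ?A" using local by blast
    ultimately have "?A \<inter> U = {} \<or> - closure ?A \<inter> U = {}" by (rule connectedD)
    moreover have "z0 \<in> ?A"
    proof -
      have "(u ^^ n) z0 = z0" for n
        using u(2) by (induction n) (auto simp: attracting_fixed_point_def)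
      then show ?thesis by (simp add: attraction_basin_def)
    qed
    ultimately show ?thesis using local True unfolding U_def u_def by blast
  next
    \<comment> \<open>If \<open>z0\<close> were outside the Fatou set, its component would be
      empty.\<close>
    case False
    then have "U = {}"
      unfolding U_def fatou_component_def
      by (auto simp: connected_component_refl_eq dest: connected_component_in)
    then show ?thesis by (simp add: U_def)
  qed
qed

section \<open>Growth against decay\<close>

lemma eventually_le_imp_bounded_above:
  fixes x :: "nat \<Rightarrow> real"
  assumes "\<forall>\<^sub>F k in sequentially. x k \<le> c"
  obtains B where "\<And>k. x k \<le> B"
proof -
  obtain n where n: "\<And>k. k \<ge> n \<Longrightarrow> x k \<le> c" using assms by (auto simp: eventually_sequentially)
  have "x k \<le> max c (Max (x ` {..n}))" for k
    using n[of k] by (cases "k \<ge> n") (auto simp: le_max_iff_disj)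
  then show thesis by (rule that)
qed

text \<open>The limsup gives \<open>ln (ln M) \<le> \<rho> * ln r\<close> for large
  \<open>r\<close>. Shifting the radius by \<open>r0\<close> turns this into one bound that also
  holds for small \<open>z\<close>.\<close>

lemma order_z_growth:
  assumes h: "h holomorphic2_on UNIV" and ord: "order_z r2 h < ereal \<rho>" and "\<rho> > 0"
  obtains r0 where "r0 \<ge> 0" "\<And>z w. cmod w \<le> r2 \<Longrightarrow> cmod (h (z, w)) \<le> exp ((r0 + cmod z) powr \<rho>)"
proof -
  let ?M = "\<lambda>r. max_modulus2 r r2 h"
  have "\<forall>\<^sub>F r in at_top. ereal (log_plus (ln (?M r)) / ln r) < ereal \<rho>"
    using ord unfolding order_z_def by (rule Limsup_lessD)
  then obtain R where R: "\<And>r. r \<ge> R \<Longrightarrow> log_plus (ln (?M r)) / ln r < \<rho>"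
    by (auto simp: eventually_at_top_linorder)
  have bound: "?M r \<le> exp (r powr \<rho>)" if "r \<ge> R" "r > 1" for r
  \<comment> \<open>Where the maximum modulus is at most 1, \<open>log_plus\<close> carries no
    information, but the bound is at least 1 anyway.\<close>
  proof (cases "?M r \<le> 1")
    case True
    then show ?thesis by (metis order.trans one_le_exp_iff powr_ge_zero)
  next
    case False
    have "ln r > 0" using that by simp
    then have "log_plus (ln (?M r)) < \<rho> * ln r" using R[OF that(1)] by (simp add: divide_less_eq)
    moreover have "ln (?M r) > 0" using False by simp
    ultimately have "ln (ln (?M r)) \<le> \<rho> * ln r" by (simp add: log_plus_def)
    then have "exp (ln (ln (?M r))) \<le> exp (\<rho> * ln r)" by simp
    then have "ln (?M r) \<le> r powr \<rho>" using \<open>ln (?M r) > 0\<close> that by (simp add: powr_def)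
    then have "exp (ln (?M r)) \<le> exp (r powr \<rho>)" by simp
    then show ?thesis using False by simp
  qed
  show thesis
  proof (rule that[of "max R 2"])
    fix z w :: complex assume w: "cmod w \<le> r2"
    define r where "r = max R 2 + cmod z"
    have "r \<ge> R" "r \<ge> 2" "cmod z \<le> r" by (auto simp: r_def intro: add_increasing2 add_increasing)
    have "continuous_on (cball 0 r \<times> cball 0 r2) h"
      using holomorphic2_on_imp_continuous_on[OF h] continuous_on_subset by blast
    then have "compact ((\<lambda>x. cmod (h x)) ` (cball 0 r \<times> cball 0 r2))"
      by (intro compact_continuous_image continuous_intros compact_Times compact_cball)
    then have bdd: "bdd_above ((\<lambda>x. cmod (h x)) ` (cball 0 r \<times> cball 0 r2))"
      by (intro bounded_imp_bdd_above compact_imp_bounded)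
    have "cmod (h (z, w)) \<le> ?M r"
      unfolding max_modulus2_def using w \<open>cmod z \<le> r\<close> by (intro cSUP_upper bdd) auto
    also have "\<dots> \<le> exp (r powr \<rho>)" using \<open>r \<ge> R\<close> \<open>r \<ge> 2\<close> by (intro bound) auto
    finally show "cmod (h (z, w)) \<le> exp ((max R 2 + cmod z) powr \<rho>)" by (simp add: r_def)
  qed simp
qed

text \<open>For \<open>\<rho> < 1\<close> the exponent \<open>(D + k t) powr \<rho>\<close> is
  sublinear in \<open>k\<close>, while \<open>ln (l ^ k)\<close> decreases linearly.\<close>

lemma geometric_decay_dominates:
  fixes l \<rho> t D :: real
  assumes "0 < l" "l < 1" "0 < \<rho>" "\<rho> < 1" "0 < t"
  obtains B where "\<And>k. l ^ k * exp ((D + real k * t) powr \<rho>) \<le> B"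
proof -
  have "(\<lambda>k. l ^ k * exp ((D + real k * t) powr \<rho>)) \<longlonglongrightarrow> 0"
    using assms by real_asymp
  from order_tendstoD(2)[OF this zero_less_one]
  have "\<forall>\<^sub>F k in sequentially. l ^ k * exp ((D + real k * t) powr \<rho>) \<le> 1"
    by (rule eventually_mono) simp
  from eventually_le_imp_bounded_above[OF this that] show thesis .
qed

text \<open>The decaying factor is 2^(1 - 2^k), and \<open>2 ^ k\<close> outgrows every power of
  \<open>k\<close>, so any finite \<open>\<rho>\<close> is admissible.\<close>

lemma superexponential_decay_dominates:
  fixes \<rho> t D :: real
  assumes "0 < \<rho>" "0 < t"
  obtains B where "\<And>k. 2 * exp (- (ln 2 * 2 ^ k)) * exp ((D + real k * t) powr \<rho>) \<le> B"
proof -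
  have "filterlim (\<lambda>k. (D + real k * t) powr \<rho> - ln 2 * 2 ^ k) at_bot sequentially"
    using assms by real_asymp
  then have "\<forall>\<^sub>F k in sequentially. (D + real k * t) powr \<rho> - ln 2 * 2 ^ k \<le> 0"
    unfolding filterlim_at_bot by blast
  then have "\<forall>\<^sub>F k in sequentially. 2 * exp (- (ln 2 * 2 ^ k)) * exp ((D + real k * t) powr \<rho>) \<le> 2"
    by eventually_elim (simp add: mult.assoc flip: exp_add)
  from eventually_le_imp_bounded_above[OF this that] show thesis .
qed

text \<open>Near 0, \<open>cmod (g w) \<le> C * (cmod w)\<^sup>2\<close>. Iterating this while
  \<open>C * cmod w \<le> 1 / 2\<close> gains the factor (1/2)^(2^k - 1).\<close>

lemma superattracting_funpow_bound:
  assumes g: "g holomorphic_on UNIV" and "g 0 = 0" "deriv g 0 = 0"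
  obtains \<delta> where "\<delta> > 0"
    "\<And>k w. cmod w \<le> \<delta> \<Longrightarrow> cmod ((g ^^ k) w) \<le> 2 * exp (- (ln 2 * 2 ^ k)) * cmod w"
proof -
  define C where "C = cmod (deriv (deriv g) 0) + 1"
  have "C > 0" unfolding C_def by (intro add_nonneg_pos) auto
  have dg: "deriv g holomorphic_on UNIV" by (intro holomorphic_deriv g) simp
  have lt: "cmod (deriv (deriv g) 0) < C" by (simp add: C_def)
  obtain s where s: "s > 0" "\<And>w. dist w 0 \<le> s \<Longrightarrow> dist (deriv g w) 0 \<le> C * dist w 0"
    using attracting_contraction[OF dg assms(3) lt] by metis
  have quad: "cmod (g w) \<le> C * (cmod w)\<^sup>2" if "cmod w \<le> s" for w
  proof -
    \<comment> \<open>The mean value inequality on the disc of radius \<open>cmod w\<close>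
      integrates the linear bound on \<open>deriv g\<close> to a quadratic one on
      \<open>g\<close>.\<close>
    have "cmod (g w - g 0) \<le> C * cmod w * cmod (w - 0)"
    proof (rule field_differentiable_bound[where S = "cball 0 (cmod w)" and f' = "deriv g"])
      fix z :: complex assume z: "z \<in> cball 0 (cmod w)"
      show "(g has_field_derivative deriv g z) (at z within cball 0 (cmod w))"
        by (rule has_field_derivative_at_within[OF holomorphic_derivI[OF g open_UNIV UNIV_I]])
      have "cmod (deriv g z) \<le> C * cmod z" using s(2)[of z] z that by auto
      also have "\<dots> \<le> C * cmod w" using z \<open>C > 0\<close> by (intro mult_left_mono) auto
      finally show "cmod (deriv g z) \<le> C * cmod w" .
    qed auto
    then show ?thesis by (simp add: assms(2) power2_eq_square mult.assoc)
  qed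
  show thesis
  proof (rule that[of "min s (1 / (2 * C))"])
    fix k w assume w: "cmod w \<le> min s (1 / (2 * C))"
    let ?a = "\<lambda>k. 2 * exp (- (ln 2 * 2 ^ k)) :: real"
    have a1: "?a k \<le> 1" for k
    proof -
      have "ln 2 * 1 \<le> ln 2 * (2 ^ k :: real)" by (intro mult_left_mono) auto
      then have "exp (- (ln 2 * 2 ^ k)) \<le> exp (- ln (2 :: real))" by simp
      then show ?thesis by (simp add: exp_minus)
    qed
    \<comment> \<open>The factor 2 left over from squaring is cancelled by
      \<open>C * cmod w \<le> 1 / 2\<close>.\<close>
    have aSuc: "(?a k)\<^sup>2 = 2 * ?a (Suc k)" for k
      by (simp add: power2_eq_square mult_ac flip: exp_add)
    have Cw: "C * cmod w \<le> 1 / 2" using w \<open>C > 0\<close> by (simp add: field_simps)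
    show "cmod ((g ^^ k) w) \<le> ?a k * cmod w"
    proof (induction k)
      case 0
      then show ?case by (simp add: exp_minus)
    next
      case (Suc k)
      have "?a k * cmod w \<le> 1 * cmod w" by (intro mult_right_mono a1) simp
      then have "cmod ((g ^^ k) w) \<le> s" using Suc w by simp
      from quad[OF this] have "cmod ((g ^^ Suc k) w) \<le> C * (cmod ((g ^^ k) w))\<^sup>2" by simp
      also have "\<dots> \<le> C * (?a k * cmod w)\<^sup>2"
        using Suc \<open>C > 0\<close> by (intro mult_left_mono power_mono) auto
      also have "\<dots> = (C * cmod w) * (?a k)\<^sup>2 * cmod w" by (simp add: power2_eq_square mult_ac)
      also have "\<dots> \<le> 1 / 2 * (?a k)\<^sup>2 * cmod w" by (intro mult_right_mono Cw) auto
      finally show ?case unfolding aSuc by simp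
    qed
  qed (use s \<open>C > 0\<close> in auto)
qed

section \<open>Bulging\<close>

text \<open>
  In the coordinate \<open>z - n T\<close>, an orbit in the disc of radius \<open>s\<close> that \<open>z \<mapsto> z + p z\<close> contracts by the
  factor \<open>\<mu>\<close> cannot leave it, because the perturbation \<open>w h\<close> stays below \<open>(1 - \<mu>) s\<close>.
\<close>
lemma perturbed_orbits_stay:
  fixes a :: "nat \<Rightarrow> real"
  assumes T: "T \<noteq> 0" and p: "p holomorphic_on UNIV" and per: "\<And>z. p (z + T) = p z"
    and attr: "attracting_fixed_point (\<lambda>z. z + p z) z0"
    and g0: "g 0 = 0"
    and f_eq: "f = (\<lambda>z. z + T + p z)"
    and F_eq: "F = (\<lambda>(z, w). (f z + w * h (z, w), g w))"
    and contF: "\<And>n. continuous_on UNIV (F ^^ n)"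
    and decay: "\<delta>0 > 0" "\<And>k w. cmod w \<le> \<delta>0 \<Longrightarrow> cmod ((g ^^ k) w) \<le> a k * cmod w"
    and a: "\<And>k. 0 \<le> a k" "\<And>k. a k \<le> 1"
    and growth: "r0 \<ge> 0" "\<rho> > 0" "\<And>z w. cmod w \<le> \<delta>0 \<Longrightarrow> cmod (h (z, w)) \<le> exp ((r0 + cmod z) powr \<rho>)"
    and dominates: "\<And>D. D \<ge> 0 \<Longrightarrow> \<exists>B. \<forall>k. a k * exp ((D + real k * cmod T) powr \<rho>) \<le> B"
    and x0: "x0 \<in> attraction_basin (\<lambda>z. z + p z) z0"
  obtains X N s where "open X" "(x0, 0) \<in> X"
    "\<And>k x. x \<in> X \<Longrightarrow> dist (fst ((F ^^ (N + k)) x)) (z0 + of_nat (N + k) * T) \<le> s"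
    "\<And>k x. x \<in> X \<Longrightarrow> cmod (snd ((F ^^ (N + k)) x)) \<le> a k * \<delta>0"
proof -
  define u where "u = (\<lambda>z. z + p z)"
  have u: "u holomorphic_on UNIV" "attracting_fixed_point u z0"
    using p attr by (auto simp: u_def intro!: holomorphic_intros)
  obtain \<mu> where \<mu>: "cmod (deriv u z0) < \<mu>" "\<mu> < 1"
    using u(2) dense unfolding attracting_fixed_point_def by blast
  then have "0 \<le> \<mu>" by (meson norm_ge_zero less_imp_le order.trans)
  obtain s where s: "s > 0" "\<And>z. dist z z0 \<le> s \<Longrightarrow> dist (u z) z0 \<le> \<mu> * dist z z0"
    using attracting_contraction[OF u(1) _ \<mu>(1)] u(2) unfolding attracting_fixed_point_def by metis
  obtain N where N: "dist ((u ^^ N) x0) z0 < s"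
    using x0 attraction_basin_iff[OF s(2) \<open>0 \<le> \<mu>\<close> \<mu>(2) s(1), of x0] unfolding u_def by blast
  \<comment> \<open>At time \<open>N + k\<close> a point within \<open>s\<close> of
    \<open>z0 + (N + k) T\<close> satisfies
    \<open>r0 + cmod z \<le> D + real k * cmod T\<close>.\<close>
  define D where "D = r0 + cmod z0 + s + real N * cmod T"
  have "D \<ge> 0" using growth s by (simp add: D_def)
  then obtain B where B: "\<And>k. a k * exp ((D + real k * cmod T) powr \<rho>) \<le> B"
    using dominates by blast
  \<comment> \<open>Chosen so that \<open>\<delta> * max B 1\<close>, which bounds the perturbation
    at every later time, is at most \<open>(1 - \<mu>) * s\<close>; the maximum keeps the divisor
    positive.\<close>
  define \<delta> where "\<delta> = min \<delta>0 ((1 - \<mu>) * s / max B 1)"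
  have "\<delta> > 0" using decay s \<mu> by (simp add: \<delta>_def)
  have "\<delta> \<le> \<delta>0" by (simp add: \<delta>_def)
  have \<delta>B: "\<delta> * max B 1 \<le> (1 - \<mu>) * s"
  proof -
    have "\<delta> \<le> (1 - \<mu>) * s / max B 1" by (simp add: \<delta>_def)
    then show ?thesis by (simp add: le_divide_eq)
  qed
  \<comment> \<open>All estimates start at time \<open>N\<close>, when the orbit of
    \<open>(x0, 0)\<close> is in the translated disc; continuity of \<open>F ^^ N\<close> carries
    them back to a neighbourhood.\<close>
  define X where "X = (F ^^ N) -` (ball (z0 + of_nat N * T) s \<times> ball 0 \<delta>)"
  have "open X" unfolding X_def by (intro open_vimage contF open_Times open_ball)
  have axis: "(F ^^ n) (x, 0) = ((u ^^ n) x + of_nat n * T, 0)" for n x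
  proof -
    have "(F ^^ n) (x, 0) = ((f ^^ n) x, 0)" by (induction n) (auto simp: F_eq g0)
    moreover have "(f ^^ n) x = (u ^^ n) x + of_nat n * T"
      unfolding f_eq u_def by (rule translated_funpow[of p T, OF per])
    ultimately show ?thesis by simp
  qed
  have "(x0, 0) \<in> X"
    using N \<open>\<delta> > 0\<close> by (simp add: X_def axis dist_commute dist_norm)
  have stay: "dist (fst ((F ^^ k) (Z, w))) (z0 + of_nat (N + k) * T) \<le> s \<and>
      snd ((F ^^ k) (Z, w)) = (g ^^ k) w"
    if Zw: "dist Z (z0 + of_nat N * T) < s" "cmod w < \<delta>" for Z w k
  proof (induction k)
    case 0
    then show ?case using Zw by simp
  next
    case (Suc k)
    define z where "z = fst ((F ^^ k) (Z, w))"
    define v where "v = (g ^^ k) w"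
    define c where "c = of_nat (N + k) * T"
    have zv: "(F ^^ k) (Z, w) = (z, v)" using Suc by (simp add: z_def v_def prod_eq_iff)
    have zc: "dist (z - c) z0 \<le> s" using Suc by (simp add: z_def c_def dist_norm algebra_simps)
    have "cmod w \<le> \<delta>0" using Zw \<open>\<delta> \<le> \<delta>0\<close> by simp
    then have v1: "cmod v \<le> a k * cmod w" by (simp add: v_def decay(2))
    also have "\<dots> \<le> a k * \<delta>" using a Zw by (intro mult_left_mono) auto
    finally have v: "cmod v \<le> a k * \<delta>" .
    have "a k * \<delta> \<le> 1 * \<delta>" using a \<open>\<delta> > 0\<close> by (intro mult_right_mono) auto
    then have "cmod v \<le> \<delta>0" using v \<open>\<delta> \<le> \<delta>0\<close> by simp
    have "cmod z \<le> cmod (z - c - z0) + cmod z0 + cmod c"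
      using norm_triangle_ineq[of "z - c - z0" "z0 + c"] norm_triangle_ineq[of z0 c] by simp
    also have "\<dots> \<le> s + cmod z0 + (real N + real k) * cmod T"
      using zc by (simp add: dist_norm c_def norm_mult flip: of_nat_add)
    finally have "r0 + cmod z \<le> D + real k * cmod T" by (simp add: D_def algebra_simps)
    then have "(r0 + cmod z) powr \<rho> \<le> (D + real k * cmod T) powr \<rho>"
      using growth by (intro powr_mono2) auto
    then have "cmod (h (z, v)) \<le> exp ((D + real k * cmod T) powr \<rho>)"
      using growth(3)[OF \<open>cmod v \<le> \<delta>0\<close>, of z] by (meson exp_le_cancel_iff order.trans)
    then have "cmod v * cmod (h (z, v)) \<le> (a k * \<delta>) * exp ((D + real k * cmod T) powr \<rho>)"
      using v by (intro mult_mono) (auto intro: order.trans[OF norm_ge_zero])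
    also have "\<dots> = \<delta> * (a k * exp ((D + real k * cmod T) powr \<rho>))" by simp
    also have "\<dots> \<le> \<delta> * max B 1" using B[of k] \<open>\<delta> > 0\<close> by (intro mult_left_mono) auto
    also note \<delta>B
    finally have pert: "cmod (v * h (z, v)) \<le> (1 - \<mu>) * s" by (simp add: norm_mult)
    \<comment> \<open>Periodicity lets the contraction of \<open>u\<close> at \<open>z0\<close> act
      in the moving coordinate \<open>z - c\<close>.\<close>
    have "p z = p (z - c)"
      using periodic_of_nat[of p T "z - c" "N + k", OF per] by (simp add: c_def)
    moreover have FSuc: "(F ^^ Suc k) (Z, w) = (f z + v * h (z, v), g v)"
      by (simp add: zv) (simp add: F_eq)
    ultimately have "fst ((F ^^ Suc k) (Z, w)) - (z0 + of_nat (N + Suc k) * T) =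
        (u (z - c) - z0) + v * h (z, v)"
      unfolding FSuc by (simp add: f_eq u_def c_def algebra_simps)
    then have "dist (fst ((F ^^ Suc k) (Z, w))) (z0 + of_nat (N + Suc k) * T) \<le>
        dist (u (z - c)) z0 + cmod (v * h (z, v))"
      by (simp only: dist_norm norm_triangle_ineq)
    \<comment> \<open>The contraction leaves room \<open>(1 - \<mu>) * s\<close> in the disc,
      exactly what the perturbation may use.\<close>
    also have "\<dots> \<le> \<mu> * s + (1 - \<mu>) * s"
      using s(2)[OF zc] mult_left_mono[OF zc \<open>0 \<le> \<mu>\<close>] pert by linarith
    also have "\<dots> = s" by (simp add: algebra_simps)
    finally have "dist (fst ((F ^^ Suc k) (Z, w))) (z0 + of_nat (N + Suc k) * T) \<le> s" .
    moreover have "snd ((F ^^ Suc k) (Z, w)) = (g ^^ Suc k) w"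
      unfolding FSuc by (simp add: v_def)
    ultimately show ?case by blast
  qed
  have split: "(F ^^ (N + k)) x = (F ^^ k) (fst ((F ^^ N) x), snd ((F ^^ N) x))" for k x
    by (simp add: funpow_add add.commute[of N])
  have inX: "dist (fst ((F ^^ N) x)) (z0 + of_nat N * T) < s" "cmod (snd ((F ^^ N) x)) < \<delta>"
    if "x \<in> X" for x
    using that by (auto simp: X_def mem_Times_iff dist_commute)
  show thesis
  proof (rule that[OF \<open>open X\<close> \<open>(x0, 0) \<in> X\<close>])
    fix k x assume "x \<in> X"
    note st = stay[OF inX[OF \<open>x \<in> X\<close>], of k, folded split]
    show "dist (fst ((F ^^ (N + k)) x)) (z0 + of_nat (N + k) * T) \<le> s" using st by blast
    have "cmod (snd ((F ^^ N) x)) \<le> \<delta>0" using inX(2)[OF \<open>x \<in> X\<close>] \<open>\<delta> \<le> \<delta>0\<close> by linarith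
    then show "cmod (snd ((F ^^ (N + k)) x)) \<le> a k * \<delta>0"
      using st decay(2)[of "snd ((F ^^ N) x)" k] mult_left_mono[OF _ a(1), of _ \<delta>0 k]
      by (metis order.trans)
  qed
qed


text \<open>Treats both cases at once: \<open>a\<close> majorizes the decay of the iterates of
  \<open>g\<close>, and \<open>dominates\<close> states that this decay beats the growth of
  \<open>h\<close> along points moving linearly to infinity.\<close>

lemma bulges:
  fixes a :: "nat \<Rightarrow> real"
  assumes T: "T \<noteq> 0" and p: "p holomorphic_on UNIV" and per: "\<And>z. p (z + T) = p z"
    and attr: "attracting_fixed_point (\<lambda>z. z + p z) z0"
    and g: "g holomorphic_on UNIV" "g 0 = 0"
    and h: "h holomorphic2_on UNIV"
    and f_eq: "f = (\<lambda>z. z + T + p z)"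
    and F_eq: "F = (\<lambda>(z, w). (f z + w * h (z, w), g w))"
    and decay: "\<delta> > 0" "\<And>k w. cmod w \<le> \<delta> \<Longrightarrow> cmod ((g ^^ k) w) \<le> a k * cmod w"
    and a: "\<And>k. 0 \<le> a k" "\<And>k. a k \<le> 1" "a \<longlonglongrightarrow> 0"
    and order: "r2 > 0" "order_z r2 h < ereal \<rho>" "\<rho> > 0"
    and dominates: "\<And>D. D \<ge> 0 \<Longrightarrow> \<exists>B. \<forall>k. a k * exp ((D + real k * cmod T) powr \<rho>) \<le> B"
  shows "fatou_component f z0 \<times> {0} \<subseteq> fatou_set hatC2_normal F \<and>
         fatou_component f z0 \<times> {0} \<subseteq> fatou_set P2_normal F \<and>
         fatou_component f z0 \<times> {0} \<subseteq> fatou_set sphere2_normal F"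
proof -
  have f: "f holomorphic_on UNIV" unfolding f_eq using p by (intro holomorphic_intros)
  have holF: "(fst \<circ> F) holomorphic2_on UNIV" "(snd \<circ> F) holomorphic2_on UNIV"
  proof -
    have "fst \<circ> F = (\<lambda>x. f (fst x) + snd x * h x)" "snd \<circ> F = (\<lambda>x. g (snd x))"
      by (auto simp: F_eq)
    then show "(fst \<circ> F) holomorphic2_on UNIV" "(snd \<circ> F) holomorphic2_on UNIV"
      using holomorphic2_on_add[OF holomorphic2_on_compose1[OF f holomorphic2_on_fst]
          holomorphic2_on_mult[OF holomorphic2_on_snd h]]
        holomorphic2_on_compose1[OF g(1) holomorphic2_on_snd] by simp_all
  qed
  have contF: "continuous_on UNIV (F ^^ n)" for n
  proof -
    have "continuous_on UNIV (\<lambda>x. ((fst \<circ> F ^^ n) x, (snd \<circ> F ^^ n) x))"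
      using holomorphic2_on_funpow[OF holF, of n]
      by (intro continuous_on_Pair holomorphic2_on_imp_continuous_on) (auto simp: o_def)
    then show ?thesis by simp
  qed
  obtain r0 where r0: "r0 \<ge> 0"
      "\<And>z w. cmod w \<le> r2 \<Longrightarrow> cmod (h (z, w)) \<le> exp ((r0 + cmod z) powr \<rho>)"
    using order_z_growth[OF h order(2,3)] by metis
  have point: "\<exists>X. open X \<and> (x0, 0) \<in> X \<and> hatC2_normal X (range (\<lambda>n. F ^^ n)) \<and>
      P2_normal X (range (\<lambda>n. F ^^ n)) \<and> sphere2_normal X (range (\<lambda>n. F ^^ n))"
    if "x0 \<in> fatou_component f z0" for x0
  proof -
    have basin: "x0 \<in> attraction_basin (\<lambda>z. z + p z) z0"
      using fatou_component_subset_basin[OF T p per attr f_eq] that by blast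
    \<comment> \<open>On this radius both the decay of the iterates of \<open>g\<close> and the
      growth bound for \<open>h\<close> are available.\<close>
    have pos: "min \<delta> r2 > 0" using decay(1) order(1) by simp
    have decay': "cmod ((g ^^ k) w) \<le> a k * cmod w" if "cmod w \<le> min \<delta> r2" for k w
      using decay(2) that by simp
    have growth: "cmod (h (z, w)) \<le> exp ((r0 + cmod z) powr \<rho>)" if "cmod w \<le> min \<delta> r2" for z w
      using r0(2) that by simp
    obtain X N s where X: "open X" "(x0, 0) \<in> X"
      and near: "\<And>k x. x \<in> X \<Longrightarrow> dist (fst ((F ^^ (N + k)) x)) (z0 + of_nat (N + k) * T) \<le> s"
      and small: "\<And>k x. x \<in> X \<Longrightarrow> cmod (snd ((F ^^ (N + k)) x)) \<le> a k * min \<delta> r2"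
      using perturbed_orbits_stay[OF T p per attr g(2) f_eq F_eq contF pos decay' a(1,2) r0(1)
          order(3) growth dominates basin] by metis
    have esc: "\<forall>\<^sub>F n in sequentially. \<forall>x\<in>X. cmod (fst ((F ^^ n) x)) > R" for R
    proof -
      \<comment> \<open>From time \<open>m\<close> on, the drift \<open>n T\<close> exceeds
        \<open>R\<close> by more than the distance \<open>s\<close> to its centre and the offset
        \<open>z0\<close> can compensate.\<close>
      obtain m :: nat where m: "(R + s + cmod z0) / cmod T < real m" using reals_Archimedean2 by blast
      have "cmod (fst ((F ^^ n) x)) > R" if "n \<ge> max m N" "x \<in> X" for n x
      proof -
        have "N \<le> n" using that by simp
        then obtain k where k: "n = N + k" using le_Suc_ex by blast
        have "R + s + cmod z0 < real m * cmod T" using m T by (simp add: divide_less_eq)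
        also have "\<dots> \<le> real n * cmod T" using that by (intro mult_right_mono) auto
        also have "\<dots> = cmod (of_nat n * T)" by (simp add: norm_mult)
        also have "\<dots> \<le> cmod (z0 + of_nat n * T) + cmod z0"
          using norm_triangle_ineq4[of "z0 + of_nat n * T" z0] by simp
        also have "cmod (z0 + of_nat n * T) \<le> cmod (fst ((F ^^ n) x)) + s"
          using near[OF \<open>x \<in> X\<close>, of k] norm_triangle_sub[of "z0 + of_nat n * T" "fst ((F ^^ n) x)"]
          by (simp only: k dist_norm norm_minus_commute)
        finally show ?thesis by simp
      qed
      then show ?thesis unfolding eventually_sequentially by blast
    qed
    have van: "\<forall>\<^sub>F n in sequentially. \<forall>x\<in>X. cmod (snd ((F ^^ n) x)) < e" if "e > 0" for e
    proof -
      have "(\<lambda>k. a k * min \<delta> r2) \<longlonglongrightarrow> 0" by (rule tendsto_mult_left_zero[OF a(3)])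
      from order_tendstoD(2)[OF this that] obtain m where m: "\<And>k. k \<ge> m \<Longrightarrow> a k * min \<delta> r2 < e"
        by (auto simp: eventually_sequentially)
      have "cmod (snd ((F ^^ n) x)) < e" if "n \<ge> N + m" "x \<in> X" for n x
      proof -
        have "N \<le> n" using that by simp
        then obtain k where k: "n = N + k" using le_Suc_ex by blast
        then have "k \<ge> m" using that by simp
        show ?thesis using small[OF that(2), of k] m[OF \<open>k \<ge> m\<close>] by (simp only: k)
      qed
      then show ?thesis unfolding eventually_sequentially by blast
    qed
    show ?thesis using X escaping_normal[OF holF esc van] by blast
  qed
  then show ?thesis by (auto simp: fatou_set_def)
qed

section \<open>The geometrically attracting and the superattracting case\<close>

theorem corollary4p5:
  fixes T z0 :: complex and p g f :: "complex \<Rightarrow> complex"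
    and h :: "complex \<times> complex \<Rightarrow> complex"
    and F :: "complex \<times> complex \<Rightarrow> complex \<times> complex"
  assumes "T \<noteq> 0"
    and "p holomorphic_on UNIV" and "\<And>z. p (z + T) = p z"
    and "attracting_fixed_point (\<lambda>z. z + p z) z0"
    and "g holomorphic_on UNIV" and "attracting_fixed_point g 0"
    and "h holomorphic2_on UNIV"
    and "f = (\<lambda>z. z + T + p z)"
    and "F = (\<lambda>(z, w). (f z + w * h (z, w), g w))"
    and "(geom_attracting_fixed_point g 0 \<and> (\<exists>r2>0. order_z r2 h < 1)) \<or>
         (superattracting_fixed_point g 0 \<and> (\<exists>r2>0. order_z r2 h < \<infinity>))"
  shows "fatou_component f z0 \<times> {0} \<subseteq> fatou_set hatC2_normal F \<and>
         fatou_component f z0 \<times> {0} \<subseteq> fatou_set P2_normal F \<and>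
         fatou_component f z0 \<times> {0} \<subseteq> fatou_set sphere2_normal F"
proof -
  have g0: "g 0 = 0" using assms(6) by (simp add: attracting_fixed_point_def)
  have T: "cmod T > 0" using assms(1) by simp
  note bulges = bulges[OF assms(1-5) g0 assms(7-9)]
  show ?thesis
    using assms(10)
  proof (elim disjE conjE exE)
    fix r2 assume "geom_attracting_fixed_point g 0" and r2: "r2 > 0" "order_z r2 h < 1"
    then have "cmod (deriv g 0) < 1" by (simp add: geom_attracting_fixed_point_def)
    \<comment> \<open>The room between the multiplier and 1 gives a genuine contraction near 0, so
      \<open>l ^ k\<close> serves as the majorant \<open>a k\<close>.\<close>
    then obtain l where l: "cmod (deriv g 0) < l" "l < 1" using dense by blast
    then have "0 < l" by (meson norm_ge_zero le_less_trans)
    obtain s where s: "s > 0" "\<And>w. dist w 0 \<le> s \<Longrightarrow> dist (g w) 0 \<le> l * dist w 0"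
      using attracting_contraction[OF assms(5) g0 l(1)] by metis
    have decay: "cmod ((g ^^ k) w) \<le> l ^ k * cmod w" if "cmod w \<le> s" for k w
      using contraction_funpow[OF s(2), where z = w and n = k] \<open>0 < l\<close> l(2) that by simp
    obtain \<rho> where "order_z r2 h < ereal \<rho>" "ereal \<rho> < 1"
      using r2(2) ereal_dense2 by blast
    \<comment> \<open>The maximum makes the exponent positive while keeping it below 1.\<close>
    then have \<rho>: "order_z r2 h < ereal (max \<rho> (1 / 2))" "0 < max \<rho> (1 / 2)" "max \<rho> (1 / 2) < 1"
      by (auto intro: less_le_trans simp: one_ereal_def)
    show ?thesis
    proof (rule bulges[OF s(1) decay _ _ _ r2(1) \<rho>(1,2)])
      show "\<exists>B. \<forall>k. l ^ k * exp ((D + real k * cmod T) powr max \<rho> (1 / 2)) \<le> B" for D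
        using geometric_decay_dominates[OF \<open>0 < l\<close> l(2) \<rho>(2,3) T, of D] by metis
    qed (use \<open>0 < l\<close> l(2) in \<open>auto intro!: power_le_one LIMSEQ_realpow_zero\<close>)
  next
    fix r2 assume "superattracting_fixed_point g 0" and r2: "r2 > 0" "order_z r2 h < \<infinity>"
    then have "deriv g 0 = 0" by (simp add: superattracting_fixed_point_def)
    let ?a = "\<lambda>k. 2 * exp (- (ln 2 * 2 ^ k)) :: real"
    obtain \<delta> where \<delta>: "\<delta> > 0" "\<And>k w. cmod w \<le> \<delta> \<Longrightarrow> cmod ((g ^^ k) w) \<le> ?a k * cmod w"
      using superattracting_funpow_bound[OF assms(5) g0 \<open>deriv g 0 = 0\<close>] by metis
    obtain \<rho> where "order_z r2 h < ereal \<rho>" using r2(2) ereal_dense2 by blast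
    then have \<rho>: "order_z r2 h < ereal (max \<rho> 1)" "0 < max \<rho> 1"
      by (auto intro: less_le_trans)
    show ?thesis
    proof (rule bulges[OF \<delta> _ _ _ r2(1) \<rho>])
      fix k :: nat
      have "ln 2 * 1 \<le> ln 2 * (2 ^ k :: real)" by (intro mult_left_mono) auto
      then have "exp (- (ln 2 * 2 ^ k)) \<le> exp (- ln (2 :: real))" by simp
      then show "?a k \<le> 1" by (simp add: exp_minus)
    next
      show "?a \<longlonglongrightarrow> 0" by real_asymp
    next
      show "\<exists>B. \<forall>k. ?a k * exp ((D + real k * cmod T) powr max \<rho> 1) \<le> B" for D
        using superexponential_decay_dominates[OF \<rho>(2) T, of D] by metis
    qed auto
  qed
qed

end
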